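(* Let $X$ be a locally compact Hausdorff space, let $U$ be a $\sigma$-compact open subset of $X$, and let $M$ be a countably generated Hilbert $C_0(X)$-module such that $M|_U\cong\ell_2(U)$. Then $M\cong M\oplus\ell_2(U)$.
   Context: $M|_U:=MC_0(U)$. $\ell_2(U)$ denotes the standard Hilbert module $\ell_2(C_0(U))\cong C_0(U,\ell_2(\mathbb N))$, regarded as a Hilbert $C_0(X)$-module (a submodule of $C_0(X,\ell_2(\mathbb N))$). $\cong$ is isomorphism of Hilbert $C_0(X)$-modules. *)

theory Defs
  imports "HOL-Analysis.Analysis"
begin

definition C0 :: "'x topology \<Rightarrow> ('x \<Rightarrow> complex) set" where
  "C0 T = {f. continuous_map T euclidean f \<and> (\<forall>x. x \<notin> topspace T \<longrightarrow> f x = 0) \<and>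
     (\<forall>e>0. \<exists>K. compactin T K \<and> (\<forall>x\<in>topspace T - K. cmod (f x) < e))}"

text \<open>C_0(U) for U open in X, regarded as the ideal of C_0(X) of functions vanishing off U.\<close>
definition C0_on :: "'x topology \<Rightarrow> 'x set \<Rightarrow> ('x \<Rightarrow> complex) set" where
  "C0_on T U = {f \<in> C0 T. \<forall>x. x \<notin> U \<longrightarrow> f x = 0}"

text \<open>Data of a (pre-)Hilbert C_0(X)-module: carrier, vector space operations,
right action of C_0(X), C_0(X)-valued inner product (conjugate-linear in the first slot).\<close>
record ('m, 'x) hmod =
  carr :: "'m set"
  zer :: 'm
  pls :: "'m \<Rightarrow> 'm \<Rightarrow> 'm"
  smul :: "complex \<Rightarrow> 'm \<Rightarrow> 'm"
  ract :: "'m \<Rightarrow> ('x \<Rightarrow> complex) \<Rightarrow> 'm"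
  ipr :: "'m \<Rightarrow> 'm \<Rightarrow> 'x \<Rightarrow> complex"

definition hsub :: "('m, 'x) hmod \<Rightarrow> 'm \<Rightarrow> 'm \<Rightarrow> 'm" where
  "hsub M a b = pls M a (smul M (-1) b)"

definition hnorm :: "('m, 'x) hmod \<Rightarrow> 'm \<Rightarrow> real" where
  "hnorm M m = sqrt (Sup (range (\<lambda>x. cmod (ipr M m m x))))"

definition hilbert_module :: "'x topology \<Rightarrow> ('m, 'x) hmod \<Rightarrow> bool" where
  "hilbert_module T M \<longleftrightarrow>
     \<comment> \<open>complex vector space\<close>
     zer M \<in> carr M \<and>
     (\<forall>a\<in>carr M. \<forall>b\<in>carr M. pls M a b \<in> carr M) \<and>
     (\<forall>c. \<forall>a\<in>carr M. smul M c a \<in> carr M) \<and>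
     (\<forall>a\<in>carr M. \<forall>b\<in>carr M. \<forall>c\<in>carr M. pls M (pls M a b) c = pls M a (pls M b c)) \<and>
     (\<forall>a\<in>carr M. \<forall>b\<in>carr M. pls M a b = pls M b a) \<and>
     (\<forall>a\<in>carr M. pls M (zer M) a = a) \<and>
     (\<forall>a\<in>carr M. \<exists>b\<in>carr M. pls M a b = zer M) \<and>
     (\<forall>c. \<forall>a\<in>carr M. \<forall>b\<in>carr M. smul M c (pls M a b) = pls M (smul M c a) (smul M c b)) \<and>
     (\<forall>c d. \<forall>a\<in>carr M. smul M (c + d) a = pls M (smul M c a) (smul M d a)) \<and>
     (\<forall>c d. \<forall>a\<in>carr M. smul M (c * d) a = smul M c (smul M d a)) \<and>
     (\<forall>a\<in>carr M. smul M 1 a = a) \<and>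
     \<comment> \<open>right C_0(X)-module\<close>
     (\<forall>a\<in>carr M. \<forall>f\<in>C0 T. ract M a f \<in> carr M) \<and>
     (\<forall>a\<in>carr M. \<forall>b\<in>carr M. \<forall>f\<in>C0 T. ract M (pls M a b) f = pls M (ract M a f) (ract M b f)) \<and>
     (\<forall>a\<in>carr M. \<forall>f\<in>C0 T. \<forall>g\<in>C0 T. ract M a (\<lambda>x. f x + g x) = pls M (ract M a f) (ract M a g)) \<and>
     (\<forall>a\<in>carr M. \<forall>f\<in>C0 T. \<forall>g\<in>C0 T. ract M (ract M a f) g = ract M a (\<lambda>x. f x * g x)) \<and>
     (\<forall>c. \<forall>a\<in>carr M. \<forall>f\<in>C0 T. ract M (smul M c a) f = smul M c (ract M a f)) \<and>
     (\<forall>c. \<forall>a\<in>carr M. \<forall>f\<in>C0 T. ract M a (\<lambda>x. c * f x) = smul M c (ract M a f)) \<and>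
     \<comment> \<open>C_0(X)-valued inner product\<close>
     (\<forall>a\<in>carr M. \<forall>b\<in>carr M. ipr M a b \<in> C0 T) \<and>
     (\<forall>a\<in>carr M. \<forall>b\<in>carr M. \<forall>c\<in>carr M. ipr M a (pls M b c) = (\<lambda>x. ipr M a b x + ipr M a c x)) \<and>
     (\<forall>d. \<forall>a\<in>carr M. \<forall>b\<in>carr M. ipr M a (smul M d b) = (\<lambda>x. d * ipr M a b x)) \<and>
     (\<forall>a\<in>carr M. \<forall>b\<in>carr M. \<forall>f\<in>C0 T. ipr M a (ract M b f) = (\<lambda>x. ipr M a b x * f x)) \<and>
     (\<forall>a\<in>carr M. \<forall>b\<in>carr M. ipr M b a = (\<lambda>x. cnj (ipr M a b x))) \<and>
     (\<forall>a\<in>carr M. \<forall>x. ipr M a a x \<in> \<real> \<and> 0 \<le> Re (ipr M a a x)) \<and>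
     (\<forall>a\<in>carr M. ipr M a a = (\<lambda>x. 0) \<longrightarrow> a = zer M) \<and>
     \<comment> \<open>completeness for the norm\<close>
     (\<forall>s. (\<forall>n. s n \<in> carr M) \<and>
          (\<forall>e>0. \<exists>N. \<forall>m\<ge>N. \<forall>n\<ge>N. hnorm M (hsub M (s m) (s n)) < e) \<longrightarrow>
          (\<exists>a\<in>carr M. (\<lambda>n. hnorm M (hsub M (s n) a)) \<longlonglongrightarrow> 0))"

inductive_set gen_span :: "('m, 'x) hmod \<Rightarrow> ('x \<Rightarrow> complex) set \<Rightarrow> 'm set \<Rightarrow> 'm set"
  for M A G where
  gs_zero: "zer M \<in> gen_span M A G"
| gs_gen: "g \<in> G \<Longrightarrow> f \<in> A \<Longrightarrow> ract M g f \<in> gen_span M A G"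
| gs_add: "a \<in> gen_span M A G \<Longrightarrow> b \<in> gen_span M A G \<Longrightarrow> pls M a b \<in> gen_span M A G"

definition hclosure :: "('m, 'x) hmod \<Rightarrow> 'm set \<Rightarrow> 'm set" where
  "hclosure M S = {m \<in> carr M. \<forall>e>0. \<exists>s\<in>S. hnorm M (hsub M m s) < e}"

definition countably_generated :: "'x topology \<Rightarrow> ('m, 'x) hmod \<Rightarrow> bool" where
  "countably_generated T M \<longleftrightarrow>
     (\<exists>G. countable G \<and> G \<subseteq> carr M \<and> carr M \<subseteq> hclosure M (gen_span M (C0 T) G))"

definition restrict_mod :: "'x topology \<Rightarrow> ('m, 'x) hmod \<Rightarrow> 'x set \<Rightarrow> ('m, 'x) hmod" where
  "restrict_mod T M U = M\<lparr>carr := hclosure M (gen_span M (C0_on T U) (carr M))\<rparr>"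

definition l2norm :: "(nat \<Rightarrow> complex) \<Rightarrow> real" where
  "l2norm a = sqrt (\<Sum>n. (cmod (a n))^2)"

text \<open>The standard module l_2(U) = C_0(U, l_2(N)), as a submodule of C_0(X, l_2(N)).\<close>
definition l2mod :: "'x topology \<Rightarrow> 'x set \<Rightarrow> ('x \<Rightarrow> nat \<Rightarrow> complex, 'x) hmod" where
  "l2mod T U = \<lparr> carr = {v. (\<forall>x. summable (\<lambda>n. (cmod (v x n))^2)) \<and>
                           (\<forall>x. x \<notin> U \<longrightarrow> v x = (\<lambda>n. 0)) \<and>
                           (\<forall>x\<in>topspace T. \<forall>e>0. \<exists>W. openin T W \<and> x \<in> W \<and>
                               (\<forall>y\<in>W. l2norm (\<lambda>n. v y n - v x n) < e)) \<and>
                           (\<forall>e>0. \<exists>K. compactin T K \<and> (\<forall>x\<in>topspace T - K. l2norm (v x) < e))},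
                 zer = (\<lambda>x n. 0),
                 pls = (\<lambda>v w x n. v x n + w x n),
                 smul = (\<lambda>c v x n. c * v x n),
                 ract = (\<lambda>v f x n. v x n * f x),
                 ipr = (\<lambda>v w x. \<Sum>n. cnj (v x n) * w x n) \<rparr>"

definition dsum :: "('m, 'x) hmod \<Rightarrow> ('n, 'x) hmod \<Rightarrow> ('m \<times> 'n, 'x) hmod" where
  "dsum M N = \<lparr> carr = carr M \<times> carr N,
                 zer = (zer M, zer N),
                 pls = (\<lambda>a b. (pls M (fst a) (fst b), pls N (snd a) (snd b))),
                 smul = (\<lambda>c a. (smul M c (fst a), smul N c (snd a))),
                 ract = (\<lambda>a f. (ract M (fst a) f, ract N (snd a) f)),
                 ipr = (\<lambda>a b x. ipr M (fst a) (fst b) x + ipr N (snd a) (snd b) x) \<rparr>"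

definition hiso :: "'x topology \<Rightarrow> ('m, 'x) hmod \<Rightarrow> ('n, 'x) hmod \<Rightarrow> bool" where
  "hiso T M N \<longleftrightarrow> (\<exists>\<phi>. bij_betw \<phi> (carr M) (carr N) \<and>
     (\<forall>a\<in>carr M. \<forall>b\<in>carr M. \<phi> (pls M a b) = pls N (\<phi> a) (\<phi> b)) \<and>
     (\<forall>c. \<forall>a\<in>carr M. \<phi> (smul M c a) = smul N c (\<phi> a)) \<and>
     (\<forall>a\<in>carr M. \<forall>f\<in>C0 T. \<phi> (ract M a f) = ract N (\<phi> a) f) \<and>
     (\<forall>a\<in>carr M. \<forall>b\<in>carr M. ipr N (\<phi> a) (\<phi> b) = ipr M a b))"

end

(* Let g in C_0(X) be positive exactly on U.  The unit vectors c(x) of l_2 whose coordinate N_n is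
   sqrt(max 0 (1 - |1/g(x) - n|)) depend continuously on x in U, and their supports run off to infinity
   as x leaves U.  Hence v(x) |-> v(x) (x) c(x) embeds l_2(U) isometrically into C_0(U, l_2 (x) l_2),
   which is M|_U.  Since M is countably generated, N_n can be chosen so sparse that the pairing of this
   copy of l_2(U) with every element of M vanishes at the boundary of U.  The embedding into M is then
   adjointable, so the copy is a direct summand of M, and l_2(U) = l_2(U) + l_2(U) gives the claim. *)
theory Submission
  imports Defs "HOL-Library.Nat_Bijection"
begin

subsection \<open>Square-summable sequences\<close>

text \<open>The obstacle is the boundary of \<open>U\<close>. An element \<open>a\<close> of
  \<open>M\<close> has coordinates over \<open>U\<close> (\<open>coord a\<close>) whose norm is
  bounded but need not tend to 0 there. The copy of \<open>l2mod T U\<close> given directly by the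
  inverse of the isomorphism is therefore not complemented in general: its pairing with
  \<open>a\<close> would have to be represented by \<open>coord a\<close>, which may fail to lie in
  \<open>l2mod T U\<close>. What does tend to 0, at each point, is the norm of the
  \<open>i\<close>-th column of \<open>coord a x\<close> as \<open>i\<close> grows. Hence the second
  factor \<open>l_2\<close>: it provides columns that recede as the boundary is approached. The
  convergence is uniform only on compact sets, so the columns are matched to the sets where
  \<open>1/(n+1) <= g x\<close>, with one more generator taken into account at each stage.
  Generators suffice because the map to the contracted coordinates is bounded, uniformly over the
  fibres. The weights are square roots because their squares must sum to 1 for an isometry. At most
  two of them are nonzero at a point, so all sums are finite and the estimates cost a factor
  2.\<close>

definition l2 :: "(nat \<Rightarrow> complex) set" where
  "l2 = {a. summable (\<lambda>n. (cmod (a n))\<^sup>2)}"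

definition l2ip :: "(nat \<Rightarrow> complex) \<Rightarrow> (nat \<Rightarrow> complex) \<Rightarrow> complex" where
  "l2ip a b = (\<Sum>n. cnj (a n) * b n)"

lemma l2norm_nonneg [simp]: "0 \<le> l2norm a" if "a \<in> l2"
  using that by (auto simp: l2norm_def l2_def intro: suminf_nonneg)

lemma l2norm_zero [simp]: "l2norm (\<lambda>n. 0) = 0"
  by (simp add: l2norm_def)

lemma l2_zero [simp]: "(\<lambda>n. 0) \<in> l2"
  by (simp add: l2_def)

lemma l2_le:
  assumes "\<And>m. (\<Sum>n<m. (cmod (a n))\<^sup>2) \<le> B\<^sup>2" "0 \<le> B"
  shows "a \<in> l2" "l2norm a \<le> B"
proof -
  show *: "a \<in> l2"
    unfolding l2_def using summableI_nonneg_bounded[of "\<lambda>n. (cmod (a n))\<^sup>2", OF _ assms(1)] by simp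
  then have "(\<Sum>n. (cmod (a n))\<^sup>2) \<le> B\<^sup>2"
    using assms(1) by (intro suminf_le_const) (auto simp: l2_def)
  then show "l2norm a \<le> B"
    unfolding l2norm_def using assms(2) real_le_lsqrt by blast
qed

lemma L2_set_le_l2norm:
  assumes "a \<in> l2" "finite A"
  shows "L2_set (\<lambda>n. cmod (a n)) A \<le> l2norm a"
  using assms unfolding L2_set_def l2norm_def l2_def by (auto intro!: sum_le_suminf)

text \<open>Minkowski's inequality for finite sums (\<open>L2_set\<close>), passed to the limit by
  \<open>l2_le\<close>.\<close>

lemma l2_add:
  assumes "a \<in> l2" "b \<in> l2"
  shows "(\<lambda>n. a n + b n) \<in> l2" "l2norm (\<lambda>n. a n + b n) \<le> l2norm a + l2norm b"
proof -
  have "(\<Sum>n<m. (cmod (a n + b n))\<^sup>2) \<le> (l2norm a + l2norm b)\<^sup>2" for m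
  proof -
    have "L2_set (\<lambda>n. cmod (a n + b n)) {..<m} \<le> L2_set (\<lambda>n. cmod (a n) + cmod (b n)) {..<m}"
      by (intro L2_set_mono norm_triangle_ineq) auto
    also have "\<dots> \<le> l2norm a + l2norm b"
      using L2_set_triangle_ineq[of "\<lambda>n. cmod (a n)" "\<lambda>n. cmod (b n)" "{..<m}"]
        L2_set_le_l2norm[OF assms(1), of "{..<m}"] L2_set_le_l2norm[OF assms(2), of "{..<m}"] by simp
    finally show ?thesis
      unfolding L2_set_def by (rule sqrt_le_D)
  qed
  from l2_le[OF this] show "(\<lambda>n. a n + b n) \<in> l2" "l2norm (\<lambda>n. a n + b n) \<le> l2norm a + l2norm b"
    using assms by auto
qed

lemma l2_mult:
  assumes "a \<in> l2"
  shows "(\<lambda>n. c * a n) \<in> l2"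
  using assms summable_mult[of "\<lambda>n. (cmod (a n))\<^sup>2" "(cmod c)\<^sup>2"]
  by (simp add: l2_def norm_mult power_mult_distrib)

lemma l2norm_mult:
  assumes "a \<in> l2"
  shows "l2norm (\<lambda>n. c * a n) = cmod c * l2norm a"
  using assms by (simp add: l2_def l2norm_def norm_mult power_mult_distrib suminf_mult real_sqrt_mult)

lemma l2_diff:
  assumes "a \<in> l2" "b \<in> l2"
  shows "(\<lambda>n. a n - b n) \<in> l2" "l2norm (\<lambda>n. a n - b n) \<le> l2norm a + l2norm b"
  using l2_add[OF assms(1) l2_mult[OF assms(2), of "-1"]] l2norm_mult[OF assms(2), of "-1"] by simp_all

lemma l2_sum:
  assumes "finite A" "\<And>i. i \<in> A \<Longrightarrow> f i \<in> l2"
  shows "(\<lambda>n. \<Sum>i\<in>A. f i n) \<in> l2 \<and> l2norm (\<lambda>n. \<Sum>i\<in>A. f i n) \<le> (\<Sum>i\<in>A. l2norm (f i))"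
  using assms
proof (induction A rule: finite_induct)
  case (insert i A)
  then show ?case
    using l2_add[of "f i" "\<lambda>n. \<Sum>i\<in>A. f i n"] by fastforce
qed simp

lemma l2_comp:
  assumes "a \<in> l2" "strict_mono s"
  shows "(\<lambda>n. a (s n)) \<in> l2" "l2norm (\<lambda>n. a (s n)) \<le> l2norm a"
proof -
  have "(\<Sum>n<m. (cmod (a (s n)))\<^sup>2) \<le> (l2norm a)\<^sup>2" for m
  proof -
    have "(\<Sum>n<m. (cmod (a (s n)))\<^sup>2) = (\<Sum>n\<in>s ` {..<m}. (cmod (a n))\<^sup>2)"
      using strict_mono_imp_inj_on[OF assms(2)] by (subst sum.reindex) (auto intro: inj_on_subset)
    also have "sqrt \<dots> \<le> l2norm a"
      using L2_set_le_l2norm[OF assms(1), of "s ` {..<m}"] by (simp add: L2_set_def)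
    finally show ?thesis
      by (rule sqrt_le_D)
  qed
  from l2_le[OF this] show "(\<lambda>n. a (s n)) \<in> l2" "l2norm (\<lambda>n. a (s n)) \<le> l2norm a"
    using assms by auto
qed

text \<open>The isometry adjoint to restriction along \<open>s\<close>, see
  \<open>l2ip_embed_left\<close>. It places one copy of \<open>l_2\<close> in the positions
  \<open>range s\<close>.\<close>

definition embed :: "(nat \<Rightarrow> nat) \<Rightarrow> (nat \<Rightarrow> complex) \<Rightarrow> nat \<Rightarrow> complex" where
  "embed s a j = (if j \<in> range s then a (inv s j) else 0)"

lemma embed_apply [simp]: "strict_mono s \<Longrightarrow> embed s a (s k) = a k"
  by (simp add: embed_def strict_mono_imp_inj_on)

lemma embed_outside: "j \<notin> range s \<Longrightarrow> embed s a j = 0"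
  by (simp add: embed_def)

lemma embed_diff: "embed s a j - embed s b j = embed s (\<lambda>n. a n - b n) j"
  by (simp add: embed_def)

lemma embed_zero [simp]: "embed s (\<lambda>n. 0) = (\<lambda>n. 0)"
  by (auto simp: embed_def)

lemma l2_embed:
  assumes "a \<in> l2" "strict_mono s"
  shows "embed s a \<in> l2" 
  using assms summable_mono_reindex[OF assms(2), of "\<lambda>n. (cmod (embed s a n))\<^sup>2"]
  by (simp add: l2_def embed_outside)

lemma l2norm_embed:
  assumes "strict_mono s"
  shows "l2norm (embed s a) = l2norm a"
  using suminf_mono_reindex[OF assms, of "\<lambda>n. (cmod (embed s a n))\<^sup>2"] assms
  by (simp add: l2norm_def embed_outside)

lemma l2ip_embed_left:
  assumes "strict_mono s"
  shows "l2ip (embed s a) b = l2ip a (\<lambda>n. b (s n))"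
  using suminf_mono_reindex[OF assms, of "\<lambda>n. cnj (embed s a n) * b n"] assms
  by (simp add: l2ip_def embed_outside)

lemma summable_l2ip:
  assumes "a \<in> l2" "b \<in> l2"
  shows "summable (\<lambda>n. cnj (a n) * b n)"
proof (rule summable_comparison_test)
  show "summable (\<lambda>n. (cmod (a n))\<^sup>2 + (cmod (b n))\<^sup>2)"
    using assms by (auto simp: l2_def intro: summable_add)
  have "cmod (a n) * cmod (b n) \<le> (cmod (a n))\<^sup>2 + (cmod (b n))\<^sup>2" for n
    using sum_squares_bound[of "cmod (a n)" "cmod (b n)"]
      mult_nonneg_nonneg[OF norm_ge_zero[of "a n"] norm_ge_zero[of "b n"]] by linarith
  then show "\<exists>N. \<forall>n\<ge>N. norm (cnj (a n) * b n) \<le> (cmod (a n))\<^sup>2 + (cmod (b n))\<^sup>2"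
    by (simp add: norm_mult)
qed

lemma l2ip_add_right:
  assumes "a \<in> l2" "b \<in> l2" "c \<in> l2"
  shows "l2ip a (\<lambda>n. b n + c n) = l2ip a b + l2ip a c"
  using assms by (simp add: l2ip_def ring_distribs suminf_add[OF summable_l2ip summable_l2ip])

lemma l2ip_mult_right:
  assumes "a \<in> l2" "b \<in> l2"
  shows "l2ip a (\<lambda>n. c * b n) = c * l2ip a b"
  using suminf_mult[OF summable_l2ip[OF assms], of c] by (simp add: l2ip_def mult.left_commute)

lemma l2ip_commute:
  assumes "a \<in> l2" "b \<in> l2"
  shows "l2ip b a = cnj (l2ip a b)"
proof -
  have "(\<lambda>n. cnj (cnj (a n) * b n)) sums cnj (l2ip a b)"
    using summable_l2ip[OF assms] unfolding l2ip_def sums_cnj by (rule summable_sums)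
  then show ?thesis
    by (simp add: l2ip_def sums_iff mult.commute)
qed

lemma l2ip_add_left:
  assumes "a \<in> l2" "b \<in> l2" "c \<in> l2"
  shows "l2ip (\<lambda>n. b n + c n) a = l2ip b a + l2ip c a"
  using assms by (simp add: l2ip_commute[of a] l2_add l2ip_add_right)

lemma l2ip_mult_left:
  assumes "a \<in> l2" "b \<in> l2"
  shows "l2ip (\<lambda>n. c * b n) a = cnj c * l2ip b a"
  using assms by (simp add: l2ip_commute[of a] l2_mult l2ip_mult_right)

lemma l2ip_zero [simp]: "l2ip (\<lambda>n. 0) a = 0" "l2ip a (\<lambda>n. 0) = 0"
  by (simp_all add: l2ip_def)

lemma l2ip_sum_right:
  assumes "finite A" "a \<in> l2" "\<And>i. i \<in> A \<Longrightarrow> f i \<in> l2"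
  shows "l2ip a (\<lambda>n. \<Sum>i\<in>A. f i n) = (\<Sum>i\<in>A. l2ip a (f i))"
  using assms(1,3)
proof (induction A rule: finite_induct)
  case (insert i A)
  have "(\<lambda>n. \<Sum>i\<in>A. f i n) \<in> l2"
    using insert by (simp add: l2_sum)
  then show ?case
    using insert assms(2) l2ip_add_right[of a "f i" "\<lambda>n. \<Sum>i\<in>A. f i n"] by simp
qed simp

lemma l2ip_sum_left:
  assumes "finite A" "a \<in> l2" "\<And>i. i \<in> A \<Longrightarrow> f i \<in> l2"
  shows "l2ip (\<lambda>n. \<Sum>i\<in>A. f i n) a = (\<Sum>i\<in>A. l2ip (f i) a)"
proof -
  have "(\<lambda>n. \<Sum>i\<in>A. f i n) \<in> l2"
    using assms by (simp add: l2_sum)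
  then have "l2ip (\<lambda>n. \<Sum>i\<in>A. f i n) a = cnj (\<Sum>i\<in>A. l2ip a (f i))"
    using assms by (simp add: l2ip_commute[of a] l2ip_sum_right)
  also have "\<dots> = (\<Sum>i\<in>A. l2ip (f i) a)"
    using assms by (simp add: l2ip_commute[of a])
  finally show ?thesis .
qed

lemma l2ip_self:
  assumes "a \<in> l2"
  shows "l2ip a a = complex_of_real ((l2norm a)\<^sup>2)"
proof -
  have eq: "cnj (a n) * a n = complex_of_real ((cmod (a n))\<^sup>2)" for n
    by (simp add: complex_norm_square mult.commute del: of_real_power)
  have "l2ip a a = complex_of_real (\<Sum>n. (cmod (a n))\<^sup>2)"
    using assms unfolding l2ip_def l2_def eq by (subst suminf_of_real) auto
  moreover have "0 \<le> (\<Sum>n. (cmod (a n))\<^sup>2)"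
    using assms by (auto simp: l2_def intro: suminf_nonneg)
  ultimately show ?thesis
    by (simp add: l2norm_def del: of_real_power)
qed

lemma l2norm_eq_0_iff:
  assumes "a \<in> l2"
  shows "l2norm a = 0 \<longleftrightarrow> a = (\<lambda>n. 0)"
  using assms by (auto simp: l2norm_def l2_def suminf_nonneg suminf_eq_zero_iff)

text \<open>The \<open>n\<close>-th subsequence only sees the tail of the series from \<open>n\<close> on.\<close>
lemma l2norm_subseq_tendsto_0:
  assumes "a \<in> l2" "\<And>n. strict_mono (s n)" "\<And>n k. n \<le> s n k"
  shows "(\<lambda>n. l2norm (\<lambda>k. a (s n k))) \<longlonglongrightarrow> 0"
proof -
  let ?f = "\<lambda>j. (cmod (a j))\<^sup>2"
  have sm: "summable ?f"
    using assms(1) by (simp add: l2_def)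
  have tail: "(\<lambda>n. \<Sum>j. ?f (j + n)) \<longlonglongrightarrow> 0"
    using suminf_exist_split2[OF sm] .
  have le: "(l2norm (\<lambda>k. a (s n k)))\<^sup>2 \<le> (\<Sum>j. ?f (j + n))" for n
  proof -
    \<comment> \<open>As \<open>n <= s n k\<close>, the truncated subtraction is exact, and
      \<open>s n\<close> becomes a subsequence of the tail that starts at \<open>n\<close>.\<close>
    have m: "strict_mono (\<lambda>k. s n k - n)"
      using assms(2,3) unfolding strict_mono_def by (meson diff_less_mono)
    have "(\<lambda>j. a (j + n)) \<in> l2"
      using sm summable_ignore_initial_segment[of ?f] by (simp add: l2_def)
    from l2_comp(2)[OF this m] l2_comp(1)[OF this m]
    have "l2norm (\<lambda>k. a (s n k)) \<le> l2norm (\<lambda>j. a (j + n))" "0 \<le> l2norm (\<lambda>k. a (s n k))"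
      using assms(3) by simp_all
    from power_mono[OF this, of 2] show ?thesis
      using sm by (simp add: l2norm_def suminf_nonneg summable_ignore_initial_segment[of ?f])
  qed
  have "(\<lambda>n. (l2norm (\<lambda>k. a (s n k)))\<^sup>2) \<longlonglongrightarrow> 0"
    by (rule tendsto_sandwich[OF _ _ tendsto_const tail]) (use le in auto)
  then show ?thesis
    by (simp add: tendsto_0_le power_tendsto_0_iff)
qed

subsection \<open>Vanishing at infinity\<close>

text \<open>Turns vanishing at infinity into a limit, so that one set of limit rules serves both
  here and at points (\<open>atin\<close>). For compact \<open>T\<close> it is the trivial
  filter.\<close>

definition at_inf :: "'x topology \<Rightarrow> 'x filter" where
  "at_inf T = (INF K\<in>{K. compactin T K}. principal (topspace T - K))"

lemma eventually_at_inf: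
  "eventually P (at_inf T) \<longleftrightarrow> (\<exists>K. compactin T K \<and> (\<forall>x\<in>topspace T - K. P x))"
  unfolding at_inf_def
proof (subst eventually_INF_base)
  show "{K. compactin T K} \<noteq> {}"
    using compactin_empty by blast
next
  fix K L assume "K \<in> {K. compactin T K}" "L \<in> {K. compactin T K}"
  then show "\<exists>N\<in>{K. compactin T K}.
      principal (topspace T - N) \<le> inf (principal (topspace T - K)) (principal (topspace T - L))"
    by (intro bexI[of _ "K \<union> L"]) (auto intro: compactin_Un)
qed (auto simp: eventually_principal)

lemma tendsto_norm_at_inf_iff:
  fixes f :: "'x \<Rightarrow> 'a::real_normed_vector"
  shows "(f \<longlongrightarrow> 0) (at_inf T) \<longleftrightarrow>
    (\<forall>e>0. \<exists>K. compactin T K \<and> (\<forall>x\<in>topspace T - K. norm (f x) < e))"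
  by (simp add: tendsto_iff eventually_at_inf)

lemma mem_C0:
  "f \<in> C0 T \<longleftrightarrow> continuous_map T euclidean f \<and> (\<forall>x. x \<notin> topspace T \<longrightarrow> f x = 0) \<and>
    (f \<longlongrightarrow> 0) (at_inf T)"
  by (simp add: C0_def tendsto_norm_at_inf_iff)

lemma C0_bounded:
  assumes "f \<in> C0 T"
  obtains B where "\<And>x. cmod (f x) \<le> B"
proof -
  obtain K where K: "compactin T K" "\<And>x. x \<in> topspace T - K \<Longrightarrow> cmod (f x) < 1"
    using assms unfolding C0_def by (auto simp: Ball_def dest: spec[of _ 1])
  have "compact (f ` K)"
    using assms K(1) image_compactin[of T K euclidean f] by (auto simp: mem_C0)
  then obtain B where "\<forall>y\<in>f ` K. cmod y \<le> B"
    using compact_imp_bounded bounded_iff by blast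
  then have "cmod (f x) \<le> B" if "x \<in> K" for x
    using that by blast
  moreover have "f x = 0" if "x \<notin> topspace T" for x
    using assms that by (simp add: mem_C0)
  ultimately have "cmod (f x) \<le> max B 1" for x
    by (cases "x \<in> K"; cases "x \<in> topspace T") (use K(2)[of x] in \<open>force+\<close>)
  then show thesis
    using that by blast
qed

text \<open>The function is a weighted sum of bump functions equal to 1 on the members of the exhaustion.\<close>
lemma ex_C0_pos_iff:
  fixes T :: "'x topology" and K :: "nat \<Rightarrow> 'x set"
  assumes lc: "locally_compact_space T" and h: "Hausdorff_space T" and U: "openin T U"
    and K: "\<And>n. compactin T (K n)" "U = (\<Union>n. K n)"
  obtains g :: "'x \<Rightarrow> real" where "(\<lambda>x. complex_of_real (g x)) \<in> C0 T" "\<And>x. 0 \<le> g x" "\<And>x. 0 < g x \<longleftrightarrow> x \<in> U"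
proof -
  define bump where "bump n f L \<longleftrightarrow> continuous_map T euclideanreal f \<and> (\<forall>x. 0 \<le> f x \<and> f x \<le> 1) \<and>
      f ` K n \<subseteq> {1} \<and> (\<forall>x. x \<notin> U \<longrightarrow> f x = 0) \<and> compactin T L \<and> (\<forall>x\<in>topspace T - L. f x = 0)"
    for n L and f :: "'x \<Rightarrow> real"
  have "\<exists>f L. bump n f L" for n
  proof -
    obtain V L where VL: "openin T V" "compactin T L" "K n \<subseteq> V" "V \<subseteq> L"
      using locally_compact_space_compact_closed_compact[of T] lc h K(1)[of n] by blast
    have cr: "completely_regular_space T"
      using lc h locally_compact_regular_imp_completely_regular_space by blast
    \<comment> \<open>Vanishing off \<open>U\<close> and off \<open>V\<close> is imposed together;
      \<open>V\<close> lies in the compact \<open>L\<close>, so the bump also vanishes off a compact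
      set.\<close>
    have "closedin T (topspace T - U \<inter> V)"
      using U VL by blast
    moreover have "disjnt (K n) (topspace T - U \<inter> V)"
      using K VL by (auto simp: disjnt_def)
    ultimately obtain f :: "'x \<Rightarrow> real" where f: "continuous_map T (top_of_set {0..1}) f"
        "f ` (topspace T - U \<inter> V) \<subseteq> {0}" "f ` K n \<subseteq> {1}"
      using Urysohn_completely_regular_compact_closed[OF zero_le_one cr K(1)] by blast
    \<comment> \<open>Membership in \<open>C0 T\<close> requires the value 0 at points of the type
      outside the space, where Urysohn's lemma says nothing.\<close>
    define f' where "f' x = (if x \<in> topspace T then f x else 0)" for x
    have "continuous_map T euclideanreal f'"
      by (rule continuous_map_eq[of _ _ f]) (use f(1) in \<open>auto simp: f'_def continuous_map_in_subtopology\<close>)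
    moreover have "0 \<le> f' x \<and> f' x \<le> 1" for x
      using f(1) by (auto simp: f'_def continuous_map_in_subtopology)
    moreover have "f' ` K n \<subseteq> {1}"
      using f(3) compactin_subset_topspace[OF K(1)[of n]] by (auto simp: f'_def)
    moreover have "f' x = 0" if "x \<notin> U \<or> x \<in> topspace T - L" for x
      using f(2) that VL(4) by (auto simp: f'_def)
    ultimately have "bump n f' L"
      using VL(2) by (simp add: bump_def)
    then show ?thesis by blast
  qed
  then obtain f :: "nat \<Rightarrow> 'x \<Rightarrow> real" and L where "\<And>n. bump n (f n) (L n)"
    by metis
  then have f: "\<And>n. continuous_map T euclideanreal (f n)" "\<And>n x. 0 \<le> f n x" "\<And>n x. f n x \<le> 1"
      "\<And>n x. x \<in> K n \<Longrightarrow> f n x = 1" "\<And>n x. x \<notin> U \<Longrightarrow> f n x = 0"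
      "\<And>n. compactin T (L n)" "\<And>n x. x \<in> topspace T - L n \<Longrightarrow> f n x = 0"
    unfolding bump_def by blast+
  define h where "h n x = (1/2)^n * f n x" for n x
  define g where "g x = (\<Sum>n. h n x)" for x
  have bound: "norm (h n x) \<le> (1/2)^n" for n x
    using f(2)[of n x] f(3)[of n x] by (simp add: h_def abs_mult mult_left_le)
  have geo: "summable (\<lambda>n. (1/2)^n :: real)"
    by simp
  have sm: "summable (\<lambda>n. h n x)" for x
    using geo bound by (rule summable_comparison_test')
  \<comment> \<open>Uniform convergence is used twice, at \<open>atin T x\<close> for continuity and
    at \<open>at_inf T\<close> for vanishing at infinity, by the same exchange of limits.\<close>
  have ul: "uniform_limit UNIV (\<lambda>n x. \<Sum>i<n. h i x) g sequentially"
    unfolding g_def using bound geo by (rule Weierstrass_m_test)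
  have "(g \<longlongrightarrow> g x) (atin T x)" if "x \<in> topspace T" for x
  proof (rule swap_uniform_limit'[OF _ _ ul])
    show "\<forall>\<^sub>F n in sequentially. ((\<lambda>x. \<Sum>i<n. h i x) \<longlongrightarrow> (\<Sum>i<n. h i x)) (atin T x)"
      using f(1) that unfolding h_def continuous_map_atin limitin_canonical_iff
      by (intro always_eventually allI tendsto_intros) auto
    show "(\<lambda>n. \<Sum>i<n. h i x) \<longlonglongrightarrow> g x"
      unfolding g_def using sm by (rule summable_LIMSEQ)
  qed auto
  then have cont: "continuous_map T euclideanreal g"
    by (simp add: continuous_map_atin)
  have "(g \<longlongrightarrow> 0) (at_inf T)"
  proof (rule swap_uniform_limit'[OF _ _ ul])
    have "(h i \<longlongrightarrow> 0) (at_inf T)" for i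
      using f(6)[of i] f(7)[of _ i] by (intro tendsto_eventually) (auto simp: eventually_at_inf h_def)
    then show "\<forall>\<^sub>F n in sequentially. ((\<lambda>x. \<Sum>i<n. h i x) \<longlongrightarrow> 0) (at_inf T)"
      by (intro always_eventually allI tendsto_null_sum)
  qed auto
  moreover have nn: "0 \<le> h n x" for n x
    using f(2) by (simp add: h_def)
  moreover have "g x = 0" if "x \<notin> U" for x
    using f(5) that by (simp add: g_def h_def)
  moreover have "0 < g x" if xU: "x \<in> U" for x
  proof -
    obtain n where "x \<in> K n"
      using K(2) xU by blast
    then have "0 < h n x"
      using f(4) by (simp add: h_def)
    then show ?thesis
      unfolding g_def using sm nn by (simp add: suminf_pos2)
  qed
  moreover have "0 \<le> g x" for x
    unfolding g_def using sm nn by (simp add: suminf_nonneg)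
  moreover have "continuous_map T euclidean (\<lambda>x. complex_of_real (g x))"
    using cont by (simp add: continuous_map_atin tendsto_of_real)
  moreover have "((\<lambda>x. complex_of_real (g x)) \<longlongrightarrow> 0) (at_inf T)"
    using \<open>(g \<longlongrightarrow> 0) (at_inf T)\<close> tendsto_of_real[of g 0 "at_inf T", where 'a = complex] by simp
  ultimately show thesis
    using openin_subset[OF U] by (intro that[of g]) (force simp: mem_C0 less_le)+
qed

section \<open>Norm-continuous sections with values in \<open>l_2\<close>, and closure properties of
  \<open>l2mod\<close>\<close>

definition l2cont_at :: "'x topology \<Rightarrow> ('x \<Rightarrow> nat \<Rightarrow> complex) \<Rightarrow> 'x \<Rightarrow> bool" where
  "l2cont_at T v x \<longleftrightarrow> ((\<lambda>y. l2norm (\<lambda>n. v y n - v x n)) \<longlongrightarrow> 0) (atin T x)"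

lemma l2norm_lt_near:
  assumes "l2cont_at T v x" "x \<in> topspace T" "0 < e" "\<And>y. v y \<in> l2"
  obtains W where "openin T W" "x \<in> W" "\<And>y. y \<in> W \<Longrightarrow> l2norm (\<lambda>n. v y n - v x n) < e"
proof -
  have "\<forall>\<^sub>F y in atin T x. dist (l2norm (\<lambda>n. v y n - v x n)) 0 < e"
    using assms(1,3) unfolding l2cont_at_def tendsto_iff by blast
  then obtain W where W: "openin T W" "x \<in> W" "\<And>y. y \<in> W - {x} \<Longrightarrow> dist (l2norm (\<lambda>n. v y n - v x n)) 0 < e"
    using assms(2) by (auto simp: eventually_atin)
  \<comment> \<open>The filter \<open>atin T x\<close> omits \<open>x\<close> itself, where the
    difference is 0.\<close>
  have "l2norm (\<lambda>n. v y n - v x n) < e" if "y \<in> W" for y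
    using W(3)[of y] assms(3) that by (cases "y = x") auto
  with W that show thesis by blast
qed

lemma l2cont_at_iff:
  assumes "\<And>y. v y \<in> l2" "x \<in> topspace T"
  shows "l2cont_at T v x \<longleftrightarrow>
    (\<forall>e>0. \<exists>W. openin T W \<and> x \<in> W \<and> (\<forall>y\<in>W. l2norm (\<lambda>n. v y n - v x n) < e))"
proof
  assume L: "\<forall>e>0. \<exists>W. openin T W \<and> x \<in> W \<and> (\<forall>y\<in>W. l2norm (\<lambda>n. v y n - v x n) < e)"
  have nn: "0 \<le> l2norm (\<lambda>n. v y n - v x n)" for y
    using assms by (simp add: l2_diff)
  show "l2cont_at T v x"
    unfolding l2cont_at_def tendsto_iff
  proof (intro allI impI)
    fix e :: real assume "0 < e"
    then obtain W where "openin T W" "x \<in> W" "\<And>y. y \<in> W \<Longrightarrow> l2norm (\<lambda>n. v y n - v x n) < e"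
      using L by meson
    then show "\<forall>\<^sub>F y in atin T x. dist (l2norm (\<lambda>n. v y n - v x n)) 0 < e"
      unfolding eventually_atin by (intro disjI2 exI[of _ W]) (simp add: nn)
  qed
next
  assume c: "l2cont_at T v x"
  show "\<forall>e>0. \<exists>W. openin T W \<and> x \<in> W \<and> (\<forall>y\<in>W. l2norm (\<lambda>n. v y n - v x n) < e)"
  proof (intro allI impI)
    fix e :: real assume "0 < e"
    then obtain W where "openin T W" "x \<in> W" "\<And>y. y \<in> W \<Longrightarrow> l2norm (\<lambda>n. v y n - v x n) < e"
      using l2norm_lt_near[OF c assms(2) _ assms(1)] by blast
    then show "\<exists>W. openin T W \<and> x \<in> W \<and> (\<forall>y\<in>W. l2norm (\<lambda>n. v y n - v x n) < e)"
      by blast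
  qed
qed

lemma mem_l2mod:
  "v \<in> carr (l2mod T U) \<longleftrightarrow> (\<forall>x. v x \<in> l2) \<and> (\<forall>x. x \<notin> U \<longrightarrow> v x = (\<lambda>n. 0)) \<and>
    (\<forall>x\<in>topspace T. l2cont_at T v x) \<and> ((\<lambda>x. l2norm (v x)) \<longlongrightarrow> 0) (at_inf T)"
\<comment> \<open>For square-summable \<open>v x\<close> the norm is nonnegative, which removes the
  absolute value from the limit; otherwise both sides are false.\<close>
proof (cases "\<forall>x. v x \<in> l2")
  case True
  then have "0 \<le> l2norm (v x)" for x
    by simp
  then have "((\<lambda>x. l2norm (v x)) \<longlongrightarrow> 0) (at_inf T) \<longleftrightarrow>
      (\<forall>e>0. \<exists>K. compactin T K \<and> (\<forall>x\<in>topspace T - K. l2norm (v x) < e))"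
    unfolding tendsto_norm_at_inf_iff by simp
  moreover have "(\<forall>x\<in>topspace T. l2cont_at T v x) \<longleftrightarrow> (\<forall>x\<in>topspace T. \<forall>e>0. \<exists>W. openin T W \<and> x \<in> W \<and>
      (\<forall>y\<in>W. l2norm (\<lambda>n. v y n - v x n) < e))"
    using True by (intro ball_cong refl l2cont_at_iff) auto
  ultimately show ?thesis
    using True by (simp only: l2mod_def l2_def hmod.simps mem_Collect_eq)
qed (auto simp: l2mod_def l2_def)

lemma l2cont_at_add:
  assumes "l2cont_at T v x" "l2cont_at T w x" "\<And>y. v y \<in> l2" "\<And>y. w y \<in> l2"
  shows "l2cont_at T (\<lambda>y n. v y n + w y n) x"
  unfolding l2cont_at_def
proof (rule tendsto_0_le[where K = 1])
  show "((\<lambda>y. l2norm (\<lambda>n. v y n - v x n) + l2norm (\<lambda>n. w y n - w x n)) \<longlongrightarrow> 0) (atin T x)"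
    using assms(1,2) unfolding l2cont_at_def by (rule tendsto_add_zero)
  have "l2norm (\<lambda>n. v y n + w y n - (v x n + w x n)) \<le> l2norm (\<lambda>n. v y n - v x n) + l2norm (\<lambda>n. w y n - w x n)" for y
    using l2_add(2)[OF l2_diff(1)[OF assms(3,3)] l2_diff(1)[OF assms(4,4)]]
    by (simp add: algebra_simps)
  then show "\<forall>\<^sub>F y in atin T x. norm (l2norm (\<lambda>n. v y n + w y n - (v x n + w x n)))
      \<le> norm (l2norm (\<lambda>n. v y n - v x n) + l2norm (\<lambda>n. w y n - w x n)) * 1"
    using assms(3,4) by (intro always_eventually) (simp add: l2_diff l2_add)
qed

text \<open>The product rule: the difference is \<open>f y\<close> times the change of
  \<open>v\<close> plus the change of \<open>f\<close> times \<open>v x\<close>, and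
  \<open>f y\<close> stays bounded because it converges.\<close>

lemma l2cont_at_mult:
  assumes "l2cont_at T v x" "(f \<longlongrightarrow> f x) (atin T x)" "\<And>y. v y \<in> l2"
  shows "l2cont_at T (\<lambda>y n. f y * v y n) x"
  unfolding l2cont_at_def
proof (rule tendsto_0_le[where K = 1])
  show "((\<lambda>y. cmod (f y) * l2norm (\<lambda>n. v y n - v x n) + cmod (f y - f x) * l2norm (v x)) \<longlongrightarrow> 0) (atin T x)"
    using assms(1,2) unfolding l2cont_at_def by (auto intro!: tendsto_eq_intros)
  have "l2norm (\<lambda>n. f y * v y n - f x * v x n)
      \<le> cmod (f y) * l2norm (\<lambda>n. v y n - v x n) + cmod (f y - f x) * l2norm (v x)" for y
    using l2_add(2)[OF l2_mult[OF l2_diff(1)[OF assms(3,3)], of "f y" y x] l2_mult[OF assms(3), of "f y - f x" x]]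
      assms(3) by (simp add: l2norm_mult l2_diff) (simp add: algebra_simps)
  then show "\<forall>\<^sub>F y in atin T x. norm (l2norm (\<lambda>n. f y * v y n - f x * v x n))
      \<le> norm (cmod (f y) * l2norm (\<lambda>n. v y n - v x n) + cmod (f y - f x) * l2norm (v x)) * 1"
    using assms(3) by (intro always_eventually) (simp add: l2_diff l2_mult)
qed

lemma l2cont_at_sum:
  assumes "finite A" "\<And>i. i \<in> A \<Longrightarrow> l2cont_at T (f i) x" "\<And>i y. i \<in> A \<Longrightarrow> f i y \<in> l2"
  shows "l2cont_at T (\<lambda>y n. \<Sum>i\<in>A. f i y n) x"
  using assms
proof (induction A rule: finite_induct)
  case (insert i A)
  then show ?case
    using l2cont_at_add[of T "f i" x "\<lambda>y n. \<Sum>i\<in>A. f i y n"] by (simp add: l2_sum)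
qed (simp add: l2cont_at_def)

lemma l2cont_at_comp:
  assumes "l2cont_at T v x" "\<And>y. v y \<in> l2" "strict_mono s"
  shows "l2cont_at T (\<lambda>y n. v y (s n)) x"
  unfolding l2cont_at_def
proof (rule tendsto_0_le[where K = 1])
  show "((\<lambda>y. l2norm (\<lambda>n. v y n - v x n)) \<longlongrightarrow> 0) (atin T x)"
    using assms(1) unfolding l2cont_at_def .
  show "\<forall>\<^sub>F y in atin T x. norm (l2norm (\<lambda>n. v y (s n) - v x (s n))) \<le> norm (l2norm (\<lambda>n. v y n - v x n)) * 1"
    using l2_comp[OF l2_diff(1)[OF assms(2,2)] assms(3)] assms(2)
    by (intro always_eventually) (simp add: l2_diff)
qed

lemma l2cont_at_embed:
  assumes "l2cont_at T v x" "strict_mono s"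
  shows "l2cont_at T (\<lambda>y. embed s (v y)) x"
  using assms unfolding l2cont_at_def by (simp add: embed_diff l2norm_embed)

lemma l2cont_at_cong:
  assumes "openin T W" "x \<in> W" "\<And>y. y \<in> W \<Longrightarrow> v y = w y" "l2cont_at T v x"
  shows "l2cont_at T w x"
proof -
  have "\<forall>\<^sub>F y in atin T x. l2norm (\<lambda>n. v y n - v x n) = l2norm (\<lambda>n. w y n - w x n)"
    using assms(1-3) by (auto simp: eventually_atin intro!: exI[of _ W])
  then show ?thesis
    using assms(4) unfolding l2cont_at_def by (rule Lim_transform_eventually[rotated])
qed

lemma l2mod_sel [simp]:
  "pls (l2mod T U) v w = (\<lambda>x n. v x n + w x n)"
  "smul (l2mod T U) c v = (\<lambda>x n. c * v x n)"
  "ract (l2mod T U) v f = (\<lambda>x n. v x n * f x)"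
  "ipr (l2mod T U) v w = (\<lambda>x. l2ip (v x) (w x))"
  by (simp_all add: l2mod_def l2ip_def)

lemma l2mod_pls_closed:
  assumes "v \<in> carr (l2mod T U)" "w \<in> carr (l2mod T U)"
  shows "(\<lambda>x n. v x n + w x n) \<in> carr (l2mod T U)"
proof -
  have "((\<lambda>x. l2norm (\<lambda>n. v x n + w x n)) \<longlongrightarrow> 0) (at_inf T)"
  proof (rule tendsto_0_le[where K = 1])
    show "((\<lambda>x. l2norm (v x) + l2norm (w x)) \<longlongrightarrow> 0) (at_inf T)"
      using assms by (intro tendsto_add_zero) (auto simp: mem_l2mod)
  qed (use assms in \<open>auto simp: mem_l2mod l2_add\<close>)
  then show ?thesis
    using assms by (auto simp: mem_l2mod l2_add l2cont_at_add)
qed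

lemma l2mod_mult_closed:
  assumes "v \<in> carr (l2mod T U)" "continuous_map T euclidean f" "\<And>x. cmod (f x) \<le> B"
  shows "(\<lambda>x n. f x * v x n) \<in> carr (l2mod T U)"
proof -
  have "((\<lambda>x. l2norm (\<lambda>n. f x * v x n)) \<longlongrightarrow> 0) (at_inf T)"
  proof (rule tendsto_0_le[where K = B])
    show "((\<lambda>x. l2norm (v x)) \<longlongrightarrow> 0) (at_inf T)"
      using assms by (auto simp: mem_l2mod)
    have l: "v x \<in> l2" for x
      using assms(1) by (simp add: mem_l2mod)
    have "norm (l2norm (\<lambda>n. f x * v x n)) \<le> norm (l2norm (v x)) * B" for x
      using l[of x] mult_left_mono[OF assms(3), of "l2norm (v x)" x]
      by (simp add: l2norm_mult mult.commute)
    then show "\<forall>\<^sub>F x in at_inf T. norm (l2norm (\<lambda>n. f x * v x n)) \<le> norm (l2norm (v x)) * B"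
      by simp
  qed
  moreover have "l2cont_at T (\<lambda>x n. f x * v x n) x" if "x \<in> topspace T" for x
    using assms(1,2) that by (intro l2cont_at_mult) (auto simp: mem_l2mod continuous_map_atin)
  ultimately show ?thesis
    using assms by (auto simp: mem_l2mod l2_mult)
qed

lemma l2mod_comp_closed:
  assumes "v \<in> carr (l2mod T U)" "strict_mono s"
  shows "(\<lambda>x n. v x (s n)) \<in> carr (l2mod T U)"
proof -
  have "((\<lambda>x. l2norm (\<lambda>n. v x (s n))) \<longlongrightarrow> 0) (at_inf T)"
  proof (rule tendsto_0_le[where K = 1])
    show "((\<lambda>x. l2norm (v x)) \<longlongrightarrow> 0) (at_inf T)"
      using assms by (auto simp: mem_l2mod)
  qed (use assms in \<open>auto simp: mem_l2mod l2_comp\<close>)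
  then show ?thesis
    using assms by (auto simp: mem_l2mod l2_comp l2cont_at_comp)
qed

lemma l2mod_embed_closed:
  assumes "v \<in> carr (l2mod T U)" "strict_mono s"
  shows "(\<lambda>x. embed s (v x)) \<in> carr (l2mod T U)"
  using assms by (auto simp: mem_l2mod l2_embed l2norm_embed l2cont_at_embed)

subsection \<open>Absorbing a complemented submodule\<close>

text \<open>Nondegeneracy stands in for the module axioms: identities are verified by pairing with all elements.\<close>
locale ip_module =
  fixes T :: "'x topology" and M :: "('m, 'x) hmod"
  assumes pls_closed: "a \<in> carr M \<Longrightarrow> b \<in> carr M \<Longrightarrow> pls M a b \<in> carr M"
    and smul_closed: "a \<in> carr M \<Longrightarrow> smul M d a \<in> carr M"
    and ract_closed: "a \<in> carr M \<Longrightarrow> f \<in> C0 T \<Longrightarrow> ract M a f \<in> carr M"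
    and ipr_pls: "a \<in> carr M \<Longrightarrow> b \<in> carr M \<Longrightarrow> c \<in> carr M \<Longrightarrow>
      ipr M a (pls M b c) x = ipr M a b x + ipr M a c x"
    and ipr_smul: "a \<in> carr M \<Longrightarrow> b \<in> carr M \<Longrightarrow> ipr M a (smul M d b) x = d * ipr M a b x"
    and ipr_ract: "a \<in> carr M \<Longrightarrow> b \<in> carr M \<Longrightarrow> f \<in> C0 T \<Longrightarrow>
      ipr M a (ract M b f) x = ipr M a b x * f x"
    and ipr_commute: "a \<in> carr M \<Longrightarrow> b \<in> carr M \<Longrightarrow> ipr M b a x = cnj (ipr M a b x)"
    and nondegenerate: "a \<in> carr M \<Longrightarrow> b \<in> carr M \<Longrightarrow>
      (\<And>c x. c \<in> carr M \<Longrightarrow> ipr M c a x = ipr M c b x) \<Longrightarrow> a = b"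
begin

lemma hsub_closed: "a \<in> carr M \<Longrightarrow> b \<in> carr M \<Longrightarrow> hsub M a b \<in> carr M"
  by (simp add: hsub_def pls_closed smul_closed)

lemma ipr_hsub: "a \<in> carr M \<Longrightarrow> b \<in> carr M \<Longrightarrow> c \<in> carr M \<Longrightarrow>
    ipr M a (hsub M b c) x = ipr M a b x - ipr M a c x"
  by (simp add: hsub_def ipr_pls ipr_smul smul_closed)

lemma ipr_pls_left: "a \<in> carr M \<Longrightarrow> b \<in> carr M \<Longrightarrow> c \<in> carr M \<Longrightarrow>
    ipr M (pls M b c) a x = ipr M b a x + ipr M c a x"
  by (simp add: ipr_commute[of a] ipr_pls pls_closed)

lemma ipr_hsub_left: "a \<in> carr M \<Longrightarrow> b \<in> carr M \<Longrightarrow> c \<in> carr M \<Longrightarrow>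
    ipr M (hsub M b c) a x = ipr M b a x - ipr M c a x"
  by (simp add: ipr_commute[of a] ipr_hsub hsub_closed)

lemma ipr_ract_left: "a \<in> carr M \<Longrightarrow> b \<in> carr M \<Longrightarrow> f \<in> C0 T \<Longrightarrow>
    ipr M (ract M b f) a x = cnj (f x) * ipr M b a x"
  by (simp add: ipr_commute[of a] ipr_ract ract_closed mult.commute)

end

lemma hilbert_moduleD:
  assumes "hilbert_module T M"
  shows "zer M \<in> carr M"
    "\<forall>a\<in>carr M. \<forall>b\<in>carr M. pls M a b \<in> carr M"
    "\<forall>c. \<forall>a\<in>carr M. smul M c a \<in> carr M"
    "\<forall>a\<in>carr M. \<forall>b\<in>carr M. \<forall>c\<in>carr M. pls M (pls M a b) c = pls M a (pls M b c)"
    "\<forall>a\<in>carr M. \<forall>b\<in>carr M. pls M a b = pls M b a"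
    "\<forall>a\<in>carr M. pls M (zer M) a = a"
    "\<forall>a\<in>carr M. \<exists>b\<in>carr M. pls M a b = zer M"
    "\<forall>c d. \<forall>a\<in>carr M. smul M (c + d) a = pls M (smul M c a) (smul M d a)"
    "\<forall>a\<in>carr M. smul M 1 a = a"
    "\<forall>a\<in>carr M. \<forall>f\<in>C0 T. ract M a f \<in> carr M"
    "\<forall>a\<in>carr M. \<forall>b\<in>carr M. \<forall>c\<in>carr M. ipr M a (pls M b c) = (\<lambda>x. ipr M a b x + ipr M a c x)"
    "\<forall>d. \<forall>a\<in>carr M. \<forall>b\<in>carr M. ipr M a (smul M d b) = (\<lambda>x. d * ipr M a b x)"
    "\<forall>a\<in>carr M. ipr M a a = (\<lambda>x. 0) \<longrightarrow> a = zer M"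
    "\<forall>a\<in>carr M. \<forall>b\<in>carr M. \<forall>f\<in>C0 T. ipr M a (ract M b f) = (\<lambda>x. ipr M a b x * f x)"
    "\<forall>a\<in>carr M. \<forall>b\<in>carr M. ipr M b a = (\<lambda>x. cnj (ipr M a b x))"
    "\<forall>a\<in>carr M. \<forall>x. ipr M a a x \<in> \<real> \<and> 0 \<le> Re (ipr M a a x)"
    "\<forall>a\<in>carr M. \<forall>b\<in>carr M. ipr M a b \<in> C0 T"
    "\<forall>a\<in>carr M. \<forall>b\<in>carr M. \<forall>f\<in>C0 T. ract M (pls M a b) f = pls M (ract M a f) (ract M b f)"
    "\<forall>a\<in>carr M. \<forall>f\<in>C0 T. \<forall>g\<in>C0 T. ract M (ract M a f) g = ract M a (\<lambda>x. f x * g x)"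
    "\<forall>c. \<forall>a\<in>carr M. \<forall>f\<in>C0 T. ract M (smul M c a) f = smul M c (ract M a f)"
  using assms unfolding hilbert_module_def by - (elim conjE, assumption)+

text \<open>Only nondegeneracy takes work. Pairing \<open>hsub M a b\<close> with itself shows that
  it is zero; to conclude \<open>a = b\<close>, the element \<open>smul M (-1) b\<close> must first
  be recognised as the additive inverse of \<open>b\<close>.\<close>

lemma hilbert_module_imp_ip_module:
  assumes "hilbert_module T M"
  shows "ip_module T M"
proof -
  note ax = hilbert_moduleD(1-9)[OF assms, rule_format]
  note ip = hilbert_moduleD(11-13)[OF assms, rule_format]
  have nondeg: "a = b" if ab: "a \<in> carr M" "b \<in> carr M"
    and eq: "\<And>c x. c \<in> carr M \<Longrightarrow> ipr M c a x = ipr M c b x" for a b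
  proof -
    let ?d = "hsub M a b"
    have nb: "smul M (-1) b \<in> carr M"
      using ab ax(3) by blast
    have d: "?d \<in> carr M"
      using ab ax(2,3) by (simp add: hsub_def)
    have "ipr M ?d ?d x = 0" for x
      using ip(1)[OF d ab(1) nb] ip(2)[OF d ab(2)] eq[OF d] by (simp add: hsub_def)
    then have z: "?d = zer M"
      using ip(3)[OF d] by blast
    \<comment> \<open>\<open>smul M 0 b\<close> equals its own double, so cancelling it against its
      inverse leaves zero.\<close>
    have zb: "smul M 0 b = zer M"
    proof -
      obtain c where c: "c \<in> carr M" "pls M (smul M 0 b) c = zer M"
        using ax(3,7) ab by blast
      have "zer M = pls M (pls M (smul M 0 b) (smul M 0 b)) c"
        using ax(8)[OF ab(2), of 0 0] c by simp
      also have "\<dots> = smul M 0 b"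
        using c ab ax(1,3,4,5,6) by metis
      finally show ?thesis by simp
    qed
    have "pls M (smul M (-1) b) b = zer M"
      using ax(8)[OF ab(2), of "-1" 1] ax(9)[OF ab(2)] zb by simp
    then have "a = pls M ?d b"
      using ab nb ax(1,4,5,6) unfolding hsub_def by metis
    then show "a = b"
      using z ax(6) ab by simp
  qed
  show ?thesis
  proof
    show "pls M a b \<in> carr M" if "a \<in> carr M" "b \<in> carr M" for a b
      using that ax by blast
    show "smul M c a \<in> carr M" if "a \<in> carr M" for a c
      using that ax by blast
    show "ract M a f \<in> carr M" if "a \<in> carr M" "f \<in> C0 T" for a f
      using that hilbert_moduleD(10)[OF assms] by blast
    show "ipr M a (pls M b c) x = ipr M a b x + ipr M a c x"
      if "a \<in> carr M" "b \<in> carr M" "c \<in> carr M" for a b c x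
      using ip(1)[OF that] by simp
    show "ipr M a (smul M d b) x = d * ipr M a b x" if "a \<in> carr M" "b \<in> carr M" for a b d x
      using ip(2)[OF that] by simp
    show "ipr M a (ract M b f) x = ipr M a b x * f x"
      if "a \<in> carr M" "b \<in> carr M" "f \<in> C0 T" for a b f x
      using hilbert_moduleD(14)[OF assms, rule_format, OF that] by simp
    show "ipr M b a x = cnj (ipr M a b x)" if "a \<in> carr M" "b \<in> carr M" for a b x
      using hilbert_moduleD(15)[OF assms, rule_format, OF that] by simp
  qed (rule nondeg)
qed

lemma ip_module_l2mod: "ip_module T (l2mod T U)"
proof
  fix a b :: "'a \<Rightarrow> nat \<Rightarrow> complex"
  assume ab: "a \<in> carr (l2mod T U)" "b \<in> carr (l2mod T U)"
    and eq: "\<And>c x. c \<in> carr (l2mod T U) \<Longrightarrow> ipr (l2mod T U) c a x = ipr (l2mod T U) c b x"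
  have nb: "(\<lambda>x n. - 1 * b x n) \<in> carr (l2mod T U)"
    using ab by (intro l2mod_mult_closed) auto
  define d where "d x n = a x n + - 1 * b x n" for x n
  have d: "d \<in> carr (l2mod T U)"
    unfolding d_def using l2mod_pls_closed[OF ab(1) nb] .
  have l: "d x \<in> l2" "a x \<in> l2" "b x \<in> l2" "(\<lambda>n. - 1 * b x n) \<in> l2" for x
    using d ab nb by (auto simp: mem_l2mod)
  have "d x = (\<lambda>n. a x n + - 1 * b x n)" for x
    by (simp add: d_def fun_eq_iff)
  then have "l2ip (d x) (d x) = l2ip (d x) (a x) + -1 * l2ip (d x) (b x)" for x
    using l2ip_add_right[OF l(1,2,4), of x x x] l2ip_mult_right[OF l(1,3), of x "-1" x]
    by (simp only:)
  then have "l2ip (d x) (d x) = 0" for x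
    using eq[OF d] by simp
  then have "d x = (\<lambda>n. 0)" for x
    using l by (simp add: l2ip_self l2norm_eq_0_iff)
  then show "a = b"
    by (auto simp: d_def fun_eq_iff)
next
  fix a b c :: "'a \<Rightarrow> nat \<Rightarrow> complex" and x f d
  assume ab: "a \<in> carr (l2mod T U)" "b \<in> carr (l2mod T U)"
  show "pls (l2mod T U) a b \<in> carr (l2mod T U)"
    using ab by (simp add: l2mod_pls_closed)
  show "ipr (l2mod T U) a (smul (l2mod T U) d b) x = d * ipr (l2mod T U) a b x"
    using ab by (simp add: mem_l2mod l2ip_mult_right)
  show "ipr (l2mod T U) b a x = cnj (ipr (l2mod T U) a b x)"
    using ab l2ip_commute[of "a x" "b x"] by (simp add: mem_l2mod)
  show "ipr (l2mod T U) a (pls (l2mod T U) b c) x = ipr (l2mod T U) a b x + ipr (l2mod T U) a c x"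
    if "c \<in> carr (l2mod T U)"
    using ab that by (simp add: mem_l2mod l2ip_add_right)
  show "ipr (l2mod T U) a (ract (l2mod T U) b f) x = ipr (l2mod T U) a b x * f x" if "f \<in> C0 T"
    using ab l2ip_mult_right[of "a x" "b x" "f x"] by (simp add: mem_l2mod mult.commute)
next
  fix a :: "'a \<Rightarrow> nat \<Rightarrow> complex" and c and f
  assume a: "a \<in> carr (l2mod T U)"
  then show "smul (l2mod T U) c a \<in> carr (l2mod T U)"
    by (simp add: l2mod_mult_closed[where B = "cmod c"])
  assume f: "f \<in> C0 T"
  then obtain B where "\<And>x. cmod (f x) \<le> B"
    using C0_bounded by blast
  then show "ract (l2mod T U) a f \<in> carr (l2mod T U)"
    using l2mod_mult_closed[OF a, of f B] f by (simp add: mem_C0 mult.commute)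
qed

section \<open>Direct sums, and isomorphisms recognised by inner products\<close>

lemma dsum_sel [simp]:
  "carr (dsum M N) = carr M \<times> carr N"
  "pls (dsum M N) a b = (pls M (fst a) (fst b), pls N (snd a) (snd b))"
  "smul (dsum M N) c a = (smul M c (fst a), smul N c (snd a))"
  "ract (dsum M N) a f = (ract M (fst a) f, ract N (snd a) f)"
  "ipr (dsum M N) a b = (\<lambda>x. ipr M (fst a) (fst b) x + ipr N (snd a) (snd b) x)"
  by (simp_all add: dsum_def)

lemma ip_module_dsum:
  assumes "ip_module T M" "ip_module T N" "carr M \<noteq> {}" "carr N \<noteq> {}"
  shows "ip_module T (dsum M N)"
proof -
  interpret M: ip_module T M by fact
  interpret N: ip_module T N by fact
  obtain m n where mn: "m \<in> carr M" "n \<in> carr N"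
    using assms by blast
  \<comment> \<open>\<open>smul M 0 m\<close> stands in for the zero element, which
    \<open>ip_module\<close> does not provide. Test elements with it as one component isolate the
    other component.\<close>
  have m0: "ipr M (smul M 0 m) a x = 0" if "a \<in> carr M" for a x
    using M.ipr_commute[OF that M.smul_closed[OF mn(1)], of 0] M.ipr_smul[OF that mn(1), of 0] by simp
  have n0: "ipr N (smul N 0 n) a x = 0" if "a \<in> carr N" for a x
    using N.ipr_commute[OF that N.smul_closed[OF mn(2)], of 0] N.ipr_smul[OF that mn(2), of 0] by simp
  show ?thesis
  proof
    fix a b
    assume ab: "a \<in> carr (dsum M N)" "b \<in> carr (dsum M N)"
      and eq: "\<And>c x. c \<in> carr (dsum M N) \<Longrightarrow> ipr (dsum M N) c a x = ipr (dsum M N) c b x"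
    show "a = b"
    proof (rule prod_eqI)
      show "fst a = fst b"
        using ab eq[of "(_, smul N 0 n)"] mn N.smul_closed
        by (intro M.nondegenerate) (auto simp: n0)
      show "snd a = snd b"
        using ab eq[of "(smul M 0 m, _)"] mn M.smul_closed
        by (intro N.nondegenerate) (auto simp: m0)
    qed
  next
    fix a b x assume "a \<in> carr (dsum M N)" "b \<in> carr (dsum M N)"
    then show "ipr (dsum M N) b a x = cnj (ipr (dsum M N) a b x)"
      using M.ipr_commute[of "fst a" "fst b" x] N.ipr_commute[of "snd a" "snd b" x] by auto
  qed (auto simp: M.pls_closed N.pls_closed M.smul_closed N.smul_closed M.ract_closed N.ract_closed
      M.ipr_pls N.ipr_pls M.ipr_smul N.ipr_smul M.ipr_ract N.ipr_ract ring_distribs)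
qed

text \<open>Inner products with images determine an element of the target, so a surjective map that
  preserves inner products respects the module operations.\<close>
lemma hiso_if_surj_preserves_ipr:
  assumes "ip_module T M" "ip_module T N"
    and onto: "\<phi> ` carr M = carr N"
    and ipr: "\<And>a b x. a \<in> carr M \<Longrightarrow> b \<in> carr M \<Longrightarrow> ipr N (\<phi> a) (\<phi> b) x = ipr M a b x"
  shows "hiso T M N"
proof -
  interpret M: ip_module T M by fact
  interpret N: ip_module T N by fact
  have in_N: "\<phi> a \<in> carr N" if "a \<in> carr M" for a
    using onto that by blast
  have eqI: "u = v" if "u \<in> carr N" "v \<in> carr N"
    "\<And>c x. c \<in> carr M \<Longrightarrow> ipr N (\<phi> c) u x = ipr N (\<phi> c) v x" for u v
  proof (rule N.nondegenerate[OF that(1,2)])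
    fix c x assume "c \<in> carr N"
    then obtain m where "m \<in> carr M" "c = \<phi> m"
      using onto by blast
    then show "ipr N c u x = ipr N c v x"
      using that(3) by blast
  qed
  have "inj_on \<phi> (carr M)"
  proof (rule inj_onI)
    fix a b assume ab: "a \<in> carr M" "b \<in> carr M" "\<phi> a = \<phi> b"
    then have "ipr M c a x = ipr M c b x" if "c \<in> carr M" for c x
      using ipr[OF that ab(1), of x] ipr[OF that ab(2), of x] by simp
    then show "a = b"
      using M.nondegenerate ab by blast
  qed
  moreover have "\<phi> (pls M a b) = pls N (\<phi> a) (\<phi> b)" if "a \<in> carr M" "b \<in> carr M" for a b
    using that by (intro eqI) (simp_all add: in_N ipr M.pls_closed N.pls_closed M.ipr_pls N.ipr_pls)
  moreover have "\<phi> (smul M c a) = smul N c (\<phi> a)" if "a \<in> carr M" for a c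
    using that by (intro eqI) (simp_all add: in_N ipr M.smul_closed N.smul_closed M.ipr_smul N.ipr_smul)
  moreover have "\<phi> (ract M a f) = ract N (\<phi> a) f" if "a \<in> carr M" "f \<in> C0 T" for a f
    using that by (intro eqI) (simp_all add: in_N ipr M.ract_closed N.ract_closed M.ipr_ract N.ipr_ract)
  ultimately show ?thesis
    unfolding hiso_def using onto ipr by (intro exI[of _ \<phi>]) (auto simp: bij_betw_def)
qed

text \<open>If \<open>L \<cong> L \<oplus> L\<close> via \<open>(A, B)\<close> is a complemented submodule of \<open>M\<close>, with inclusion \<open>Q\<close> and
  coordinate map \<open>P = Q\<^sup>*\<close>, then \<open>m \<mapsto> (m - QPm + QAPm, BPm)\<close> splits a copy of \<open>L\<close> off \<open>M\<close>.\<close>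
lemma hiso_dsum_absorb:
  assumes "ip_module T M" "ip_module T L"
    and P: "\<And>m. m \<in> carr M \<Longrightarrow> P m \<in> carr L" and Q: "\<And>v. v \<in> carr L \<Longrightarrow> Q v \<in> carr M"
    and adj: "\<And>v m x. v \<in> carr L \<Longrightarrow> m \<in> carr M \<Longrightarrow> ipr M (Q v) m x = ipr L v (P m) x"
    and PQ: "\<And>v. v \<in> carr L \<Longrightarrow> P (Q v) = v"
    and A: "\<And>v. v \<in> carr L \<Longrightarrow> A v \<in> carr L" and B: "\<And>v. v \<in> carr L \<Longrightarrow> B v \<in> carr L"
    and AB: "\<And>v w x. v \<in> carr L \<Longrightarrow> w \<in> carr L \<Longrightarrow> ipr L (A v) (A w) x + ipr L (B v) (B w) x = ipr L v w x"
    and AB_onto: "\<And>v w. v \<in> carr L \<Longrightarrow> w \<in> carr L \<Longrightarrow> \<exists>p\<in>carr L. A p = v \<and> B p = w"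
    and ne: "carr M \<noteq> {}"
  shows "hiso T M (dsum M L)"
proof -
  interpret M: ip_module T M by fact
  interpret L: ip_module T L by fact
  define \<phi> where "\<phi> m = (pls M (hsub M m (Q (P m))) (Q (A (P m))), B (P m))" for m
  note closed = P Q A B M.pls_closed M.hsub_closed L.pls_closed L.hsub_closed
  have adj': "ipr M m (Q v) x = ipr L (P m) v x" if "v \<in> carr L" "m \<in> carr M" for v m x
    using that by (simp add: M.ipr_commute[of "Q v"] L.ipr_commute[of v] adj closed)
  have P_eq: "P (pls M (hsub M m (Q v)) (Q w)) = pls L (hsub L (P m) v) w"
    if "m \<in> carr M" "v \<in> carr L" "w \<in> carr L" for m v w
  proof (rule L.nondegenerate)
    fix c x assume c: "c \<in> carr L"
    have "ipr L c (P (pls M (hsub M m (Q v)) (Q w))) x = ipr M (Q c) (pls M (hsub M m (Q v)) (Q w)) x"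
      using that c by (simp add: adj closed)
    also have "\<dots> = ipr L c (pls L (hsub L (P m) v) w) x"
      using that c by (simp add: M.ipr_pls M.ipr_hsub L.ipr_pls L.ipr_hsub adj PQ closed)
    finally show "ipr L c (P (pls M (hsub M m (Q v)) (Q w))) x = ipr L c (pls L (hsub L (P m) v) w) x" .
  qed (use that in \<open>simp_all add: closed\<close>)
  \<comment> \<open>\<open>m - QPm\<close> is orthogonal to the range of \<open>Q\<close>, and
    \<open>Q\<close> is isometric. So the first components contribute
    \<open><a,b> - <Pa,Pb> + <APa,APb>\<close>, and \<open>AB\<close> absorbs the term
    \<open><BPa,BPb>\<close> of the second.\<close>
  have "ipr (dsum M L) (\<phi> a) (\<phi> b) x = ipr M a b x" if "a \<in> carr M" "b \<in> carr M" for a b x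
    using that AB[of "P a" "P b" x]
    by (simp add: \<phi>_def closed M.ipr_pls M.ipr_hsub M.ipr_pls_left M.ipr_hsub_left adj adj' PQ
        P_eq L.ipr_pls_left L.ipr_hsub_left)
  moreover have "\<phi> ` carr M = carr (dsum M L)"
  proof
    show "\<phi> ` carr M \<subseteq> carr (dsum M L)"
      by (auto simp: \<phi>_def closed)
    show "carr (dsum M L) \<subseteq> \<phi> ` carr M"
    proof
      fix z assume "z \<in> carr (dsum M L)"
      then obtain y b where z: "z = (y, b)" "y \<in> carr M" "b \<in> carr L"
        by auto
      then obtain p where p: "p \<in> carr L" "A p = P y" "B p = b"
        using AB_onto P by blast
      \<comment> \<open>Exchanges the coordinate \<open>P y\<close> of \<open>y\<close> for
        \<open>p\<close>. As \<open>A p = P y\<close>, the map sends \<open>m\<close> back to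
        \<open>y\<close> in the first component, and \<open>B p\<close> is the required second
        one.\<close>
      define m where "m = pls M (hsub M y (Q (P y))) (Q p)"
      have m: "m \<in> carr M"
        using z p by (simp add: m_def closed)
      have Pm: "P m = p"
        unfolding m_def using z p by (subst P_eq; (intro L.nondegenerate)?)
          (simp_all add: closed L.ipr_pls L.ipr_hsub)
      have "pls M (hsub M m (Q p)) (Q (P y)) = y"
        using z p m by (intro M.nondegenerate) (simp_all add: closed m_def M.ipr_pls M.ipr_hsub)
      then show "z \<in> \<phi> ` carr M"
        using z p m Pm by (intro image_eqI[of _ _ m]) (simp_all add: \<phi>_def)
    qed
  qed
  ultimately show ?thesis
    using ip_module_dsum[OF assms(1,2) ne] ne P
    by (intro hiso_if_surj_preserves_ipr[of T M _ \<phi>] assms(1)) blast+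
qed

text \<open>Even and odd positions give a unitary from \<open>l2mod T U\<close> onto two copies of
  itself; these are the properties \<open>AB\<close> and \<open>AB_onto\<close> required by
  \<open>hiso_dsum_absorb\<close>.\<close>

lemma l2mod_split:
  assumes "v \<in> carr (l2mod T U)" "w \<in> carr (l2mod T U)"
  shows "l2ip (\<lambda>n. v x (2 * n)) (\<lambda>n. w x (2 * n)) + l2ip (\<lambda>n. v x (2 * n + 1)) (\<lambda>n. w x (2 * n + 1))
    = l2ip (v x) (w x)"
    and "\<exists>p\<in>carr (l2mod T U). (\<lambda>x n. p x (2 * n)) = v \<and> (\<lambda>x n. p x (2 * n + 1)) = w"
proof -
  let ?e = "\<lambda>n::nat. 2 * n" and ?o = "\<lambda>n::nat. 2 * n + 1"
  have s: "strict_mono ?e" "strict_mono ?o"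
    by (auto simp: strict_mono_def)
  have l: "v x \<in> l2" "w x \<in> l2"
    using assms by (auto simp: mem_l2mod)
  have "?o n \<notin> range ?e" "?e n \<notin> range ?o" for n
    by auto presburger+
  then have dis: "embed ?e a (?o n) = 0" "embed ?o a (?e n) = 0" for a n
    by (simp_all only: embed_outside not_False_eq_True)
  have "v x = (\<lambda>j. embed ?e (\<lambda>n. v x (?e n)) j + embed ?o (\<lambda>n. v x (?o n)) j)"
  proof
    fix j
    show "v x j = embed ?e (\<lambda>n. v x (?e n)) j + embed ?o (\<lambda>n. v x (?o n)) j"
    proof (cases "even j")
      case True
      then obtain k where "j = ?e k" by blast
      then show ?thesis
        using embed_apply[OF s(1)] dis(2)[of _ k] by simp
    next
      case False
      then obtain k where "j = ?o k" using oddE by blast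
      then show ?thesis
        using embed_apply[OF s(2)] dis(1)[of _ k] by simp
    qed
  qed
  then have "l2ip (v x) (w x)
      = l2ip (\<lambda>j. embed ?e (\<lambda>n. v x (?e n)) j + embed ?o (\<lambda>n. v x (?o n)) j) (w x)"
    by (rule arg_cong)
  also have "\<dots> = l2ip (\<lambda>n. v x (?e n)) (\<lambda>n. w x (?e n)) + l2ip (\<lambda>n. v x (?o n)) (\<lambda>n. w x (?o n))"
    using l2ip_add_left[OF l(2) l2_embed[OF l2_comp(1)[OF l(1) s(1)] s(1)] l2_embed[OF l2_comp(1)[OF l(1) s(2)] s(2)]]
    unfolding l2ip_embed_left[OF s(1)] l2ip_embed_left[OF s(2)] .
  finally show "l2ip (\<lambda>n. v x (2 * n)) (\<lambda>n. w x (2 * n)) + l2ip (\<lambda>n. v x (2 * n + 1)) (\<lambda>n. w x (2 * n + 1))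
    = l2ip (v x) (w x)"
    by simp
  have "(\<lambda>x j. embed ?e (v x) j + embed ?o (w x) j) \<in> carr (l2mod T U)"
    using assms s by (intro l2mod_pls_closed l2mod_embed_closed)
  moreover have "embed ?e (v x) (?e n) + embed ?o (w x) (?e n) = v x n"
    "embed ?e (v x) (?o n) + embed ?o (w x) (?o n) = w x n" for x n
    using embed_apply[OF s(1)] embed_apply[OF s(2)] dis by simp_all
  ultimately show "\<exists>p\<in>carr (l2mod T U). (\<lambda>x n. p x (2 * n)) = v \<and> (\<lambda>x n. p x (2 * n + 1)) = w"
    by (intro bexI[of _ "\<lambda>x j. embed ?e (v x) j + embed ?o (w x) j"]) auto
qed

subsection \<open>Moving unit vectors\<close>

text \<open>The squares are tents centred at the integers, which form a partition of unity on
  \<open>t >= 0\<close>. Thus \<open>hat t\<close> is a unit vector of \<open>l_2\<close> that moves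
  continuously with \<open>t\<close> and is supported at the integers closer to \<open>t\<close>
  than 1.\<close>

definition hat :: "real \<Rightarrow> nat \<Rightarrow> real" where
  "hat t n = sqrt (max 0 (1 - \<bar>t - real n\<bar>))"

lemma hat_nonneg: "0 \<le> hat t n" and hat_le_1: "hat t n \<le> 1"
  by (simp_all add: hat_def)

lemma hat_eq_0_iff: "hat t n = 0 \<longleftrightarrow> 1 \<le> \<bar>t - real n\<bar>"
  by (auto simp: hat_def max_def)

text \<open>The right-hand side does not mention \<open>k\<close>. Cutoffs may therefore be changed
  freely, which \<open>blend_eq\<close> exploits.\<close>

lemma sum_hat_support:
  fixes F :: "nat \<Rightarrow> 'a::comm_monoid_add"
  assumes "0 \<le> t" "t \<le> real k" "\<And>n. hat t n = 0 \<Longrightarrow> F n = 0"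
  shows "(\<Sum>n\<le>k. F n) = F (nat \<lfloor>t\<rfloor>) + F (Suc (nat \<lfloor>t\<rfloor>))"
proof -
  have "(\<Sum>n\<le>k. F n) = (\<Sum>n\<in>{nat \<lfloor>t\<rfloor>, Suc (nat \<lfloor>t\<rfloor>)}. F n)"
  proof (rule sum.mono_neutral_cong)
    \<comment> \<open>The index after the floor can exceed \<open>k\<close> only when
      \<open>t = k\<close>, and there its weight is 0.\<close>
    show "F n = 0" if n: "n \<in> {nat \<lfloor>t\<rfloor>, Suc (nat \<lfloor>t\<rfloor>)} - {..k}" for n
    proof -
      have "real n \<ge> real k + 1"
        using n by auto
      then show "F n = 0"
        using assms(2) by (intro assms(3)) (simp add: hat_eq_0_iff)
    qed
    show "F n = 0" if n: "n \<in> {..k} - {nat \<lfloor>t\<rfloor>, Suc (nat \<lfloor>t\<rfloor>)}" for n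
    proof -
      have "int n < \<lfloor>t\<rfloor> \<or> \<lfloor>t\<rfloor> + 2 \<le> int n"
        using assms(1) n by auto
      then have "1 \<le> \<bar>t - real n\<bar>"
        by linarith
      then show "F n = 0"
        by (intro assms(3)) (simp add: hat_eq_0_iff)
    qed
  qed auto
  then show ?thesis by simp
qed

lemma sum_hat_squares:
  assumes "0 \<le> t" "t \<le> real k"
  shows "(\<Sum>n\<le>k. (hat t n)\<^sup>2) = 1"
proof -
  define m where "m = nat \<lfloor>t\<rfloor>"
  have m: "real m \<le> t" "t \<le> real m + 1"
    unfolding m_def using assms(1) by linarith+
  have sq: "(hat t n)\<^sup>2 = max 0 (1 - \<bar>t - real n\<bar>)" for n
    by (simp add: hat_def)
  have "max 0 (1 - \<bar>t - real m\<bar>) = 1 - (t - real m)" "max 0 (1 - \<bar>t - real (Suc m)\<bar>) = t - real m"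
    using m by (simp_all add: max_def abs_if)
  moreover have "(\<Sum>n\<le>k. (hat t n)\<^sup>2) = (hat t m)\<^sup>2 + (hat t (Suc m))\<^sup>2"
    unfolding m_def by (rule sum_hat_support[OF assms]) simp
  ultimately show ?thesis
    unfolding sq by linarith
qed

lemma tendsto_hat:
  assumes "(f \<longlongrightarrow> t) F"
  shows "((\<lambda>y. complex_of_real (hat (f y) n)) \<longlongrightarrow> complex_of_real (hat t n)) F"
  unfolding hat_def by (intro tendsto_intros assms)

text \<open>The factor 2 counts the two possible nonzero terms, each with a weight of at most
  1.\<close>

lemma sum_hat_le:
  assumes "0 \<le> t" "t \<le> real k" "0 \<le> B" "\<And>n. hat t n \<noteq> 0 \<Longrightarrow> a n \<le> B"
  shows "(\<Sum>n\<le>k. hat t n * a n) \<le> 2 * B"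
proof -
  have "hat t n * a n \<le> B" for n
  proof (cases "hat t n = 0")
    case False
    then have "hat t n * a n \<le> hat t n * B"
      using assms(4) hat_nonneg by (intro mult_left_mono) auto
    also have "\<dots> \<le> B"
      using assms(3) hat_le_1 hat_nonneg by (simp add: mult_left_le_one_le)
    finally show ?thesis .
  qed (use assms in simp)
  from add_mono[OF this[of "nat \<lfloor>t\<rfloor>"] this[of "Suc (nat \<lfloor>t\<rfloor>)"]]
  have "hat t (nat \<lfloor>t\<rfloor>) * a (nat \<lfloor>t\<rfloor>) + hat t (Suc (nat \<lfloor>t\<rfloor>)) * a (Suc (nat \<lfloor>t\<rfloor>)) \<le> 2 * B"
    by simp
  moreover have "(\<Sum>n\<le>k. hat t n * a n)
      = hat t (nat \<lfloor>t\<rfloor>) * a (nat \<lfloor>t\<rfloor>) + hat t (Suc (nat \<lfloor>t\<rfloor>)) * a (Suc (nat \<lfloor>t\<rfloor>))"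
    by (rule sum_hat_support[OF assms(1,2)]) simp
  ultimately show ?thesis
    by (simp only:)
qed

text \<open>Near the boundary of \<open>U\<close> and towards infinity \<open>1 / g x\<close> grows,
  and only the sections \<open>F n\<close> with \<open>n\<close> close to it are seen. The ceiling
  is the first cutoff that captures all nonzero weights.\<close>

definition blend :: "'x set \<Rightarrow> ('x \<Rightarrow> real) \<Rightarrow> (nat \<Rightarrow> 'x \<Rightarrow> nat \<Rightarrow> complex) \<Rightarrow> 'x \<Rightarrow> nat \<Rightarrow> complex" where
  "blend U g F x = (if x \<in> U then (\<lambda>j. \<Sum>n\<le>nat \<lceil>1 / g x\<rceil>. complex_of_real (hat (1 / g x) n) * F n x j)
     else (\<lambda>j. 0))"

locale C0_pos_on =
  fixes T :: "'x topology" and U :: "'x set" and g :: "'x \<Rightarrow> real"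
  assumes openU: "openin T U"
    and g_C0: "(\<lambda>x. complex_of_real (g x)) \<in> C0 T"
    and g_nonneg: "0 \<le> g x"
    and g_pos: "0 < g x \<longleftrightarrow> x \<in> U"
begin

lemma g_eq_0: "x \<notin> U \<Longrightarrow> g x = 0"
  using g_nonneg[of x] g_pos[of x] by linarith

lemma U_topspace: "x \<in> U \<Longrightarrow> x \<in> topspace T"
  using openin_subset[OF openU] by blast

lemma g_C0_on: "(\<lambda>x. complex_of_real (g x)) \<in> C0_on T U"
  using g_C0 g_eq_0 by (simp add: C0_on_def)

lemma g_tendsto: "(g \<longlongrightarrow> g x) (atin T x)" if "x \<in> topspace T"
proof -
  have "((\<lambda>y. complex_of_real (g y)) \<longlongrightarrow> complex_of_real (g x)) (atin T x)"
    using g_C0 that by (auto simp: mem_C0 continuous_map_atin)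
  from tendsto_Re[OF this] show ?thesis by simp
qed

lemma g_at_inf: "(g \<longlongrightarrow> 0) (at_inf T)"
proof -
  have "((\<lambda>y. complex_of_real (g y)) \<longlongrightarrow> 0) (at_inf T)"
    using g_C0 by (auto simp: mem_C0)
  from tendsto_Re[OF this] show ?thesis by simp
qed

lemma compactin_g_ge:
  assumes "0 < e"
  shows "compactin T {x \<in> topspace T. e \<le> g x}"
proof -
  have "continuous_map T euclideanreal g"
    using g_tendsto by (auto simp: continuous_map_atin)
  then have "closedin T {x \<in> topspace T. g x \<in> {e..}}"
    by (rule closedin_continuous_map_preimage) simp
  moreover obtain K where "compactin T K" "\<And>x. x \<in> topspace T - K \<Longrightarrow> norm (g x) < e"
    using g_at_inf assms unfolding tendsto_norm_at_inf_iff by blast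
  moreover have "{x \<in> topspace T. g x \<in> {e..}} \<subseteq> K"
    using calculation(3) by force
  ultimately show ?thesis
    using closed_compactin[of T K] by simp
qed

text \<open>The cutoff in \<open>blend\<close> jumps with \<open>x\<close>; here it is replaced by
  any larger one, so that a single \<open>k\<close> can serve a whole neighbourhood.\<close>

lemma blend_eq:
  assumes "x \<in> U" "1 / g x \<le> real k"
  shows "blend U g F x j = (\<Sum>n\<le>k. complex_of_real (hat (1 / g x) n) * F n x j)"
proof -
  have t: "0 \<le> 1 / g x"
    using g_nonneg by simp
  have "1 / g x \<le> real (nat \<lceil>1 / g x\<rceil>)"
    by linarith
  from sum_hat_support[OF t this, of "\<lambda>n. complex_of_real (hat (1 / g x) n) * F n x j"]
    sum_hat_support[OF t assms(2), of "\<lambda>n. complex_of_real (hat (1 / g x) n) * F n x j"]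
  have "(\<Sum>n\<le>nat \<lceil>1 / g x\<rceil>. complex_of_real (hat (1 / g x) n) * F n x j)
      = (\<Sum>n\<le>k. complex_of_real (hat (1 / g x) n) * F n x j)"
    by simp
  then show ?thesis
    unfolding blend_def using assms(1) by (simp only: if_True)
qed

lemma ex_bound: obtains k where "1 / g x \<le> real k"
  using real_arch_simple by blast

lemma blend_outside: "x \<notin> U \<Longrightarrow> blend U g F x = (\<lambda>j. 0)"
  by (simp add: blend_def)

lemma blend_l2:
  assumes "\<And>n. F n x \<in> l2"
  shows "blend U g F x \<in> l2"
  using l2_sum[of "{..nat \<lceil>1 / g x\<rceil>}" "\<lambda>n j. complex_of_real (hat (1 / g x) n) * F n x j"] assms
  by (simp add: blend_def l2_mult)

lemma l2norm_blend_le: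
  assumes "\<And>n. F n x \<in> l2" "0 \<le> B" "\<And>n. x \<in> U \<Longrightarrow> hat (1 / g x) n \<noteq> 0 \<Longrightarrow> l2norm (F n x) \<le> B"
  shows "l2norm (blend U g F x) \<le> 2 * B"
proof (cases "x \<in> U")
  case True
  obtain k where k: "1 / g x \<le> real k" by (rule ex_bound)
  have "l2norm (blend U g F x) = l2norm (\<lambda>j. \<Sum>n\<le>k. complex_of_real (hat (1 / g x) n) * F n x j)"
    using True k by (intro arg_cong[of _ _ l2norm] ext blend_eq)
  also have "\<dots> \<le> (\<Sum>n\<le>k. l2norm (\<lambda>j. complex_of_real (hat (1 / g x) n) * F n x j))"
    using l2_sum[of "{..k}" "\<lambda>n j. complex_of_real (hat (1 / g x) n) * F n x j"] assms
    by (simp add: l2_mult)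
  also have "\<dots> = (\<Sum>n\<le>k. hat (1 / g x) n * l2norm (F n x))"
    using assms hat_nonneg by (simp add: l2norm_mult)
  also have "\<dots> \<le> 2 * B"
    using g_nonneg k assms True by (intro sum_hat_le) auto
  finally show ?thesis .
qed (use assms in \<open>simp add: blend_outside\<close>)

lemma l2cont_at_blend:
  assumes x: "x \<in> U" and l2: "\<And>n y. F n y \<in> l2" and c: "\<And>n. l2cont_at T (F n) x"
  shows "l2cont_at T (blend U g F) x"
proof -
  have gx: "0 < g x" "x \<in> topspace T"
    using x g_pos U_topspace by auto
  have inv: "((\<lambda>y. 1 / g y) \<longlongrightarrow> 1 / g x) (atin T x)"
    by (intro tendsto_intros g_tendsto) (use gx in auto)
  \<comment> \<open>The strict inequality persists near \<open>x\<close>, so \<open>blend\<close> is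
    locally a sum with a fixed number of continuous terms.\<close>
  obtain k where k: "1 / g x < real k"
    using reals_Archimedean2 by blast
  then have "\<forall>\<^sub>F y in atin T x. 1 / g y < real k"
    using inv order_tendstoD(2) by blast
  then obtain W where W: "openin T W" "x \<in> W" "\<And>y. y \<in> W - {x} \<Longrightarrow> 1 / g y < real k"
    using gx by (auto simp: eventually_atin)
  have "l2cont_at T (\<lambda>y j. \<Sum>n\<in>{..k}. complex_of_real (hat (1 / g y) n) * F n y j) x"
  proof (rule l2cont_at_sum)
    fix n assume "n \<in> {..k}"
    show "l2cont_at T (\<lambda>y j. complex_of_real (hat (1 / g y) n) * F n y j) x"
      by (rule l2cont_at_mult[OF c tendsto_hat[OF inv] l2])
  qed (use l2 in \<open>auto intro: l2_mult\<close>)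
  moreover have "blend U g F y = (\<lambda>j. \<Sum>n\<in>{..k}. complex_of_real (hat (1 / g y) n) * F n y j)"
    if "y \<in> W \<inter> U" for y
  proof -
    have "1 / g y \<le> real k"
      using W(3)[of y] k that by (cases "y = x") auto
    then show ?thesis
      using that by (intro ext blend_eq) auto
  qed
  ultimately show ?thesis
    using W x openU by (intro l2cont_at_cong[of T "W \<inter> U" x _ "blend U g F"]) auto
qed

text \<open>Off \<open>U\<close> the section is 0, so continuity there means only that the norm
  tends to 0.\<close>

lemma l2modI:
  assumes "\<And>x. v x \<in> l2" "\<And>x. x \<notin> U \<Longrightarrow> v x = (\<lambda>n. 0)" "\<And>x. x \<in> U \<Longrightarrow> l2cont_at T v x"
    and "\<And>x. x \<in> topspace T - U \<Longrightarrow> ((\<lambda>y. l2norm (v y)) \<longlongrightarrow> 0) (atin T x)"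
    and "((\<lambda>y. l2norm (v y)) \<longlongrightarrow> 0) (at_inf T)"
  shows "v \<in> carr (l2mod T U)"
proof -
  have "l2cont_at T v x" if "x \<in> topspace T" for x
  proof (cases "x \<in> U")
    case False
    then show ?thesis
      using assms(2,4) that by (simp add: l2cont_at_def)
  qed (rule assms(3))
  then show ?thesis
    using assms by (simp add: mem_l2mod)
qed

text \<open>One condition for both ways of leaving \<open>U\<close>: \<open>g\<close> tends to 0 at
  the points outside \<open>U\<close> and at infinity alike.\<close>

definition decays :: "('x \<Rightarrow> nat \<Rightarrow> complex) \<Rightarrow> bool" where
  "decays v \<longleftrightarrow> (\<forall>e>0. \<exists>d>0. \<forall>x\<in>U. g x < d \<longrightarrow> l2norm (v x) < e)"

lemma tendsto_0_if_decays:
  assumes "decays v" "\<And>x. v x \<in> l2" "\<And>x. x \<notin> U \<Longrightarrow> v x = (\<lambda>n. 0)" "(g \<longlongrightarrow> 0) F"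
  shows "((\<lambda>y. l2norm (v y)) \<longlongrightarrow> 0) F"
  unfolding tendsto_iff
proof (intro allI impI)
  fix e :: real assume e: "0 < e"
  then obtain d where d: "0 < d" "\<And>x. x \<in> U \<Longrightarrow> g x < d \<Longrightarrow> l2norm (v x) < e"
    using assms(1) unfolding decays_def by blast
  have "dist (l2norm (v y)) 0 < e" if "g y < d" for y
    using d(2)[of y] that assms(2,3)[of y] e by (cases "y \<in> U") auto
  moreover have "\<forall>\<^sub>F y in F. g y < d"
    using assms(4) d(1) order_tendstoD(2) by blast
  ultimately show "\<forall>\<^sub>F y in F. dist (l2norm (v y)) 0 < e"
    by (auto elim: eventually_mono)
qed

lemma l2modI_decays:
  assumes "\<And>x. v x \<in> l2" "\<And>x. x \<notin> U \<Longrightarrow> v x = (\<lambda>n. 0)" "\<And>x. x \<in> U \<Longrightarrow> l2cont_at T v x" "decays v"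
  shows "v \<in> carr (l2mod T U)"
proof (rule l2modI[OF assms(1-3)])
  show "((\<lambda>y. l2norm (v y)) \<longlongrightarrow> 0) (atin T x)" if "x \<in> topspace T - U" for x
    using g_tendsto[of x] g_eq_0[of x] that by (intro tendsto_0_if_decays assms) auto
  show "((\<lambda>y. l2norm (v y)) \<longlongrightarrow> 0) (at_inf T)"
    using g_at_inf by (intro tendsto_0_if_decays assms)
qed

text \<open>A Dini-type argument: pointwise convergence to 0 along the subsequences is locally uniform.\<close>
lemma uniformly_small_subseq:
  assumes l2: "\<And>x. v x \<in> l2" and c: "\<And>x. x \<in> U \<Longrightarrow> l2cont_at T v x"
    and s: "\<And>i. strict_mono (s i)" "\<And>i k. i \<le> s i k" and "0 < d" "0 < e"
  shows "\<exists>b. \<forall>i\<ge>b. \<forall>x\<in>U. d \<le> g x \<longrightarrow> l2norm (\<lambda>k. v x (s i k)) < e"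
proof -
  have "\<exists>Wb. openin T (fst Wb) \<and> x \<in> fst Wb \<and> (\<forall>y\<in>fst Wb. \<forall>i\<ge>snd Wb. l2norm (\<lambda>k. v y (s i k)) < e)"
    if x: "x \<in> U" for x
  proof -
    have e2: "0 < e / 2"
      using \<open>0 < e\<close> by simp
    obtain W where W: "openin T W" "x \<in> W" "\<And>y. y \<in> W \<Longrightarrow> l2norm (\<lambda>n. v y n - v x n) < e / 2"
      by (rule l2norm_lt_near[OF c[OF x] U_topspace[OF x] e2 l2]) blast
    have "\<forall>\<^sub>F i in sequentially. l2norm (\<lambda>k. v x (s i k)) < e / 2"
      by (rule order_tendstoD(2)[OF l2norm_subseq_tendsto_0[of "v x" s, OF l2 s] e2])
    then obtain b where b: "\<And>i. b \<le> i \<Longrightarrow> l2norm (\<lambda>k. v x (s i k)) < e / 2"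
      by (auto simp: eventually_sequentially)
    \<comment> \<open>Passing to a subsequence does not increase the norm, so closeness of
      \<open>v y\<close> to \<open>v x\<close> transfers to every \<open>i\<close> at once, and the
      threshold \<open>b\<close> found at \<open>x\<close> works on all of \<open>W\<close>.\<close>
    have "l2norm (\<lambda>k. v y (s i k)) < e" if "y \<in> W" "b \<le> i" for y i
    proof -
      have "l2norm (\<lambda>k. v y (s i k))
          = l2norm (\<lambda>k. (v y (s i k) - v x (s i k)) + v x (s i k))"
        by simp
      also have "\<dots> \<le> l2norm (\<lambda>k. v y (s i k) - v x (s i k)) + l2norm (\<lambda>k. v x (s i k))"
        by (rule l2_add(2)[OF l2_comp(1)[OF l2_diff(1)[OF l2[of y] l2[of x]] s(1)[of i]] l2_comp(1)[OF l2[of x] s(1)[of i]]])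
      also have "\<dots> \<le> l2norm (\<lambda>n. v y n - v x n) + l2norm (\<lambda>k. v x (s i k))"
        by (rule add_right_mono[OF l2_comp(2)[OF l2_diff(1)[OF l2[of y] l2[of x]] s(1)[of i]]])
      also have "\<dots> < e"
        using W(3)[OF that(1)] b[OF that(2)] by linarith
      finally show ?thesis .
    qed
    with W show ?thesis by (intro exI[of _ "(W, b)"]) simp
  qed
  then obtain Wb where "\<forall>x\<in>U. openin T (fst (Wb x)) \<and> x \<in> fst (Wb x) \<and>
      (\<forall>y\<in>fst (Wb x). \<forall>i\<ge>snd (Wb x). l2norm (\<lambda>k. v y (s i k)) < e)"
    using bchoice[of U "\<lambda>x Wb. openin T (fst Wb) \<and> x \<in> fst Wb \<and>
      (\<forall>y\<in>fst Wb. \<forall>i\<ge>snd Wb. l2norm (\<lambda>k. v y (s i k)) < e)"] by blast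
  then obtain W b where Wb: "\<And>x. x \<in> U \<Longrightarrow> openin T (W x)" "\<And>x. x \<in> U \<Longrightarrow> x \<in> W x"
      "\<And>x y i. x \<in> U \<Longrightarrow> y \<in> W x \<Longrightarrow> b x \<le> i \<Longrightarrow> l2norm (\<lambda>k. v y (s i k)) < e"
    using that[of "\<lambda>x. fst (Wb x)" "\<lambda>x. snd (Wb x)"] by blast
  let ?C = "{x \<in> topspace T. d \<le> g x}"
  have CU: "?C \<subseteq> U"
  proof
    fix x assume "x \<in> ?C"
    then have "0 < g x"
      using \<open>0 < d\<close> by simp
    then show "x \<in> U"
      using g_pos by blast
  qed
  have "openin T V" if "V \<in> W ` ?C" for V
    using Wb(1) CU that by blast
  moreover have "?C \<subseteq> \<Union>(W ` ?C)"
    using Wb(2) CU by blast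
  ultimately have "\<exists>\<F>. finite \<F> \<and> \<F> \<subseteq> W ` ?C \<and> ?C \<subseteq> \<Union>\<F>"
    using compactin_g_ge[OF \<open>0 < d\<close>] by (rule compactinD[rotated])
  then obtain \<F> where "finite \<F>" "\<F> \<subseteq> W ` ?C" "?C \<subseteq> \<Union>\<F>"
    by blast
  then obtain X where X: "finite X" "X \<subseteq> ?C" "?C \<subseteq> \<Union>(W ` X)"
    using finite_subset_image[of \<F> W ?C] by blast
  \<comment> \<open>The finite subcover leaves finitely many thresholds; the inserted 0 keeps
    \<open>Max\<close> meaningful when there are none.\<close>
  have "l2norm (\<lambda>k. v x (s i k)) < e" if i: "Max (insert 0 (b ` X)) \<le> i" and x: "x \<in> U" "d \<le> g x" for i x
  proof -
    have "x \<in> ?C"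
      using x U_topspace by simp
    then obtain z where z: "z \<in> X" "x \<in> W z"
      using X(3) by blast
    then have "b z \<le> i"
      using i X(1) by auto
    moreover have "z \<in> U"
      using z X(2) CU by blast
    ultimately show ?thesis
      using z Wb(3) by blast
  qed
  then show ?thesis by blast
qed

end

subsection \<open>The embedded copy of the standard module\<close>

lemma cmod_ipr_le_hnorm:
  assumes "hilbert_module T M" "a \<in> carr M"
  shows "cmod (ipr M a a x) \<le> (hnorm M a)\<^sup>2" "0 \<le> hnorm M a"
proof -
  have "ipr M a a \<in> C0 T"
    using hilbert_moduleD(17)[OF assms(1)] assms(2) by blast
  then obtain B where B: "\<And>x. cmod (ipr M a a x) \<le> B"
    using C0_bounded by blast
  have le: "cmod (ipr M a a x) \<le> Sup (range (\<lambda>x. cmod (ipr M a a x)))" for x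
    using B by (intro cSUP_upper bdd_aboveI[of _ B]) auto
  then have "0 \<le> Sup (range (\<lambda>x. cmod (ipr M a a x)))"
    using norm_ge_zero order_trans by blast
  with le[of x] show "cmod (ipr M a a x) \<le> (hnorm M a)\<^sup>2" "0 \<le> hnorm M a"
    by (simp_all add: hnorm_def)
qed

text \<open>The degenerate case of the Cauchy-Schwarz inequality in one fibre: if \<open>a\<close>
  is null at \<open>x\<close>, then the square of \<open>b + d a\<close> at \<open>x\<close> is
  real-affine in \<open>d\<close>, which nonnegativity forbids unless the slope vanishes.\<close>

lemma ipr_eq_0_if_null:
  assumes "hilbert_module T M" "a \<in> carr M" "b \<in> carr M" "ipr M a a x = 0"
  shows "ipr M a b x = 0"
proof (rule ccontr)
  interpret ip_module T M
    using assms(1) by (rule hilbert_module_imp_ip_module)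
  let ?z = "ipr M a b x"
  assume z: "?z \<noteq> 0"
  \<comment> \<open>Chosen so that the square of \<open>b + d a\<close> at \<open>x\<close> becomes
    \<open>- <b,b> - 2\<close>, which is negative.\<close>
  define r where "r = (Re (ipr M b b x) + 1) / (cmod ?z)\<^sup>2"
  define d where "d = - complex_of_real r * ?z"
  let ?v = "pls M b (smul M d a)"
  have v: "?v \<in> carr M"
    using assms by (simp add: pls_closed smul_closed)
  have c: "ipr M b a x = cnj ?z"
    using assms by (simp add: ipr_commute[of a b])
  have "ipr M b ?v x = ipr M b b x + d * cnj ?z" "ipr M a ?v x = ?z"
    using assms c by (simp_all add: ipr_pls ipr_smul smul_closed)
  then have "ipr M ?v b x = cnj (ipr M b b x + d * cnj ?z)" "ipr M ?v a x = cnj ?z"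
    using ipr_commute[OF assms(3) v] ipr_commute[OF assms(2) v] by simp_all
  moreover have "ipr M ?v ?v x = ipr M ?v b x + d * ipr M ?v a x"
    using assms v by (simp add: ipr_pls[of ?v b] ipr_smul smul_closed)
  ultimately have "Re (ipr M ?v ?v x) = Re (ipr M b b x) + 2 * Re (d * cnj ?z)"
    by simp
  moreover have "Re (d * cnj ?z) = - (r * (cmod ?z)\<^sup>2)"
  proof -
    have "d * cnj ?z = - complex_of_real r * complex_of_real ((cmod ?z)\<^sup>2)"
      unfolding d_def complex_norm_square by (simp only: mult.assoc)
    then show ?thesis by simp
  qed
  moreover have "r * (cmod ?z)\<^sup>2 = Re (ipr M b b x) + 1"
    using z by (simp add: r_def)
  moreover have "0 \<le> Re (ipr M ?v ?v x)" "0 \<le> Re (ipr M b b x)"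
    using hilbert_moduleD(16)[OF assms(1)] v assms(3) by blast+
  ultimately show False
    by linarith
qed

lemma (in ip_module) gen_span_subset:
  assumes "zer M \<in> carr M" "A \<subseteq> C0 T" "G \<subseteq> carr M"
  shows "gen_span M A G \<subseteq> carr M"
proof
  fix a assume "a \<in> gen_span M A G"
  then show "a \<in> carr M"
    using assms by (induction rule: gen_span.induct) (auto intro: pls_closed ract_closed)
qed

text \<open>Column \<open>i\<close> of \<open>l\<^sub>2\<close> viewed as \<open>l\<^sub>2 \<otimes> l\<^sub>2\<close>.\<close>
definition colm :: "nat \<Rightarrow> nat \<Rightarrow> nat" where
  "colm i k = prod_encode (k, i)"

lemma strict_mono_colm: "strict_mono (colm i)"
  unfolding strict_mono_Suc_iff colm_def by (simp add: prod_encode_def)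

lemma le_colm: "i \<le> colm i k"
  by (simp add: colm_def le_prod_encode_2)

lemma embed_colm: "embed (colm i) a (colm j k) = (if i = j then a k else 0)"
proof (cases "i = j")
  case False
  then have "colm j k \<notin> range (colm i)"
    by (auto simp: colm_def)
  then show ?thesis
    using False by (simp add: embed_outside)
qed (simp add: embed_apply[OF strict_mono_colm])

section \<open>Fibre coordinates over \<open>U\<close> of the elements of \<open>M\<close>\<close>

locale trivialized_module = C0_pos_on T U g
  for T :: "'x topology" and U :: "'x set" and g :: "'x \<Rightarrow> real" +
  fixes M :: "('m, 'x) hmod" and \<psi> :: "'m \<Rightarrow> 'x \<Rightarrow> nat \<Rightarrow> complex"
  assumes hilb: "hilbert_module T M"
    and bij: "bij_betw \<psi> (carr (restrict_mod T M U)) (carr (l2mod T U))"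
    and psi_pls: "\<lbrakk>a \<in> carr (restrict_mod T M U); b \<in> carr (restrict_mod T M U)\<rbrakk> \<Longrightarrow>
      \<psi> (pls M a b) = (\<lambda>x n. \<psi> a x n + \<psi> b x n)"
    and psi_smul: "a \<in> carr (restrict_mod T M U) \<Longrightarrow> \<psi> (smul M c a) = (\<lambda>x n. c * \<psi> a x n)"
    and psi_ract: "\<lbrakk>a \<in> carr (restrict_mod T M U); f \<in> C0 T\<rbrakk> \<Longrightarrow>
      \<psi> (ract M a f) = (\<lambda>x n. \<psi> a x n * f x)"
    and psi_ipr: "\<lbrakk>a \<in> carr (restrict_mod T M U); b \<in> carr (restrict_mod T M U)\<rbrakk> \<Longrightarrow>
      l2ip (\<psi> a x) (\<psi> b x) = ipr M a b x"
begin

sublocale ip_module T M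
  using hilb by (rule hilbert_module_imp_ip_module)

abbreviation "R \<equiv> carr (restrict_mod T M U)"
abbreviation "L \<equiv> carr (l2mod T U)"
abbreviation "gc \<equiv> \<lambda>x. complex_of_real (g x)"

lemma R_subset: "R \<subseteq> carr M"
  by (auto simp: restrict_mod_def hclosure_def)

lemma ract_g_in_R: "a \<in> carr M \<Longrightarrow> ract M a gc \<in> R"
proof -
  assume a: "a \<in> carr M"
  let ?m = "ract M a gc"
  have m: "?m \<in> carr M"
    using a g_C0 by (rule ract_closed)
  \<comment> \<open>The restriction is defined as a closure; an element of the span lies in it
    because its distance to itself is 0.\<close>
  have d: "hsub M ?m ?m \<in> carr M"
    using m by (simp add: hsub_closed)
  have "ipr M (hsub M ?m ?m) (hsub M ?m ?m) x = 0" for x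
    using m d by (simp add: ipr_hsub)
  then have "hnorm M (hsub M ?m ?m) = 0"
    by (simp add: hnorm_def)
  moreover have "?m \<in> gen_span M (C0_on T U) (carr M)"
    using a g_C0_on by (rule gs_gen)
  ultimately have "\<exists>s\<in>gen_span M (C0_on T U) (carr M). hnorm M (hsub M ?m s) < e" if "0 < e" for e
    using that by (intro bexI[of _ ?m]) simp_all
  then show ?thesis
    using m by (simp add: restrict_mod_def hclosure_def)
qed

lemma psi_in_L: "a \<in> R \<Longrightarrow> \<psi> a \<in> L"
  using bij by (auto simp: bij_betw_def)

text \<open>Multiplying by \<open>g\<close> moves \<open>a\<close> into the restriction to \<open>U\<close>; dividing by \<open>g\<close> afterwards gives
  the fibre coordinates over \<open>U\<close> of an arbitrary element of \<open>M\<close>.\<close>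
definition coord :: "'m \<Rightarrow> 'x \<Rightarrow> nat \<Rightarrow> complex" where
  "coord a x = (\<lambda>n. complex_of_real (inverse (g x)) * \<psi> (ract M a gc) x n)"

lemma psi_l2: "a \<in> R \<Longrightarrow> \<psi> a x \<in> l2"
  using psi_in_L by (simp add: mem_l2mod)

lemma coord_l2: "a \<in> carr M \<Longrightarrow> coord a x \<in> l2"
  by (simp add: coord_def l2_mult psi_l2 ract_g_in_R)

lemma g_nz: "x \<in> U \<Longrightarrow> g x \<noteq> 0"
  using g_pos[of x] by simp

text \<open>Each argument brings one factor \<open>g x\<close> through the action and one factor
  \<open>1 / g x\<close> through \<open>coord\<close>; as \<open>g\<close> is real, all of them
  cancel.\<close>

lemma l2ip_coord:
  assumes "a \<in> carr M" "b \<in> carr M" "x \<in> U"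
  shows "l2ip (coord a x) (coord b x) = ipr M a b x"
proof -
  let ?i = "complex_of_real (inverse (g x))"
  note R = ract_g_in_R[OF assms(1)] ract_g_in_R[OF assms(2)]
  have "l2ip (coord a x) (coord b x) = cnj ?i * (?i * l2ip (\<psi> (ract M a gc) x) (\<psi> (ract M b gc) x))"
    unfolding coord_def l2ip_mult_left[OF l2_mult[OF psi_l2[OF R(2), of x], of ?i] psi_l2[OF R(1), of x], of ?i]
      l2ip_mult_right[OF psi_l2[OF R(1), of x] psi_l2[OF R(2), of x], of ?i] ..
  also have "l2ip (\<psi> (ract M a gc) x) (\<psi> (ract M b gc) x) = gc x * (ipr M a b x * gc x)"
    using assms R g_C0 by (simp add: psi_ipr ipr_ract ipr_ract_left ract_closed)
  finally show ?thesis
    using g_nz[OF assms(3)] by (simp add: field_simps)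
qed

lemma l2norm_coord_le:
  assumes "a \<in> carr M" "x \<in> U"
  shows "l2norm (coord a x) \<le> hnorm M a"
proof -
  have "complex_of_real ((l2norm (coord a x))\<^sup>2) = ipr M a a x"
    using l2ip_self[OF coord_l2[OF assms(1)]] l2ip_coord[OF assms(1,1,2)] by simp
  then have "(l2norm (coord a x))\<^sup>2 = cmod (ipr M a a x)"
    by (metis abs_of_nonneg norm_of_real zero_le_power2)
  also have "\<dots> \<le> (hnorm M a)\<^sup>2"
    using cmod_ipr_le_hnorm[OF hilb assms(1)] by blast
  finally show ?thesis
    using cmod_ipr_le_hnorm(2)[OF hilb assms(1)] by (rule power2_le_imp_le)
qed

lemma coord_R:
  assumes "a \<in> R" "x \<in> U"
  shows "coord a x = \<psi> a x"
  using psi_ract[OF assms(1) g_C0] g_nz[OF assms(2)] by (simp add: coord_def fun_eq_iff)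

text \<open>Continuity is confined to \<open>U\<close>: \<open>1 / g\<close> is unbounded near a
  boundary point, and the coordinates may have no limit there.\<close>

lemma l2cont_at_coord:
  assumes "a \<in> carr M" "x \<in> U"
  shows "l2cont_at T (coord a) x"
  unfolding coord_def
proof (rule l2cont_at_mult)
  show "l2cont_at T (\<psi> (ract M a gc)) x"
    using psi_in_L[OF ract_g_in_R[OF assms(1)]] U_topspace[OF assms(2)] by (simp add: mem_l2mod)
  show "((\<lambda>x. complex_of_real (inverse (g x))) \<longlongrightarrow> complex_of_real (inverse (g x))) (atin T x)"
    by (intro tendsto_intros g_tendsto) (use assms g_nz U_topspace in auto)
qed (rule psi_l2[OF ract_g_in_R[OF assms(1)]])

lemma coord_pls:
  assumes "a \<in> carr M" "b \<in> carr M"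
  shows "coord (pls M a b) x n = coord a x n + coord b x n"
  using assms ract_g_in_R g_C0 hilbert_moduleD(18)[OF hilb]
  by (simp add: coord_def psi_pls ring_distribs)

lemma coord_smul:
  assumes "a \<in> carr M"
  shows "coord (smul M c a) x n = c * coord a x n"
  using assms ract_g_in_R g_C0 hilbert_moduleD(20)[OF hilb]
  by (simp add: coord_def psi_smul)

lemma coord_ract:
  assumes "a \<in> carr M" "f \<in> C0 T"
  shows "coord (ract M a f) x n = f x * coord a x n"
proof -
  have "ract M (ract M a f) gc = ract M (ract M a gc) f"
    using assms g_C0 hilbert_moduleD(19)[OF hilb] by (simp add: mult.commute)
  then show ?thesis
    using psi_ract[OF ract_g_in_R[OF assms(1)] assms(2)] by (simp add: coord_def)
qed

section \<open>The embedding of \<open>l2mod T U\<close> and its adjoint, fibre by fibre\<close>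

definition compress :: "(nat \<Rightarrow> nat) \<Rightarrow> 'm \<Rightarrow> 'x \<Rightarrow> nat \<Rightarrow> complex" where
  "compress N a = blend U g (\<lambda>n x k. coord a x (colm (N n) k))"

text \<open>The tensor of \<open>v x\<close> with the moving unit vector whose entry in column
  \<open>N n\<close> is \<open>hat (1 / g x) n\<close>. \<open>compress\<close> contracts
  coordinates against the same vector and is the fibrewise adjoint, see
  \<open>l2ip_spread\<close>.\<close>

definition spread :: "(nat \<Rightarrow> nat) \<Rightarrow> ('x \<Rightarrow> nat \<Rightarrow> complex) \<Rightarrow> 'x \<Rightarrow> nat \<Rightarrow> complex" where
  "spread N v = blend U g (\<lambda>n x. embed (colm (N n)) (v x))"

lemma coord_colm_l2:
  assumes "a \<in> carr M"
  shows "(\<lambda>k. coord a x (colm i k)) \<in> l2" "l2norm (\<lambda>k. coord a x (colm i k)) \<le> l2norm (coord a x)"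
  using l2_comp[OF coord_l2[OF assms, of x] strict_mono_colm[of i]] .

lemma l2cont_at_compress:
  assumes "a \<in> carr M" "x \<in> U"
  shows "l2cont_at T (compress N a) x"
  unfolding compress_def
proof (rule l2cont_at_blend[OF assms(2)])
  show "l2cont_at T (\<lambda>x k. coord a x (colm (N n) k)) x" for n
    by (rule l2cont_at_comp[OF l2cont_at_coord[OF assms] coord_l2[OF assms(1)] strict_mono_colm])
qed (rule coord_colm_l2[OF assms(1)])

lemma compress_l2: "a \<in> carr M \<Longrightarrow> compress N a x \<in> l2"
  unfolding compress_def by (rule blend_l2) (rule coord_colm_l2)

text \<open>A bound that is uniform over \<open>U\<close> and linear in \<open>hnorm\<close>, as
  needed to pass decay to limits in \<open>decays_closed\<close>.\<close>

lemma l2norm_compress_le: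
  assumes "a \<in> carr M" "x \<in> U"
  shows "l2norm (compress N a x) \<le> 2 * hnorm M a"
  unfolding compress_def
proof (rule l2norm_blend_le)
  show "l2norm (\<lambda>k. coord a x (colm (N n) k)) \<le> hnorm M a" for n
    using coord_colm_l2(2)[OF assms(1)] l2norm_coord_le[OF assms] order_trans by blast
  show "0 \<le> hnorm M a"
    using cmod_ipr_le_hnorm(2)[OF hilb assms(1)] .
qed (rule coord_colm_l2[OF assms(1)])

lemma compress_pls:
  assumes "a \<in> carr M" "b \<in> carr M"
  shows "compress N (pls M a b) x k = compress N a x k + compress N b x k"
  using assms by (simp add: compress_def blend_def coord_pls ring_distribs sum.distrib)

lemma compress_smul:
  assumes "a \<in> carr M"
  shows "compress N (smul M c a) x k = c * compress N a x k"
  using assms by (simp add: compress_def blend_def coord_smul sum_distrib_left mult.left_commute)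

lemma compress_ract:
  assumes "a \<in> carr M" "f \<in> C0 T"
  shows "compress N (ract M a f) x k = f x * compress N a x k"
  using assms by (simp add: compress_def blend_def coord_ract sum_distrib_left mult.left_commute)

lemma compress_hsub:
  assumes "a \<in> carr M" "b \<in> carr M"
  shows "compress N (hsub M a b) x k = compress N a x k - compress N b x k"
  using assms by (simp add: hsub_def compress_pls compress_smul smul_closed)

section \<open>Decay of the adjoint, and the choice of the columns\<close>

lemma decays_closed:
  assumes "S \<subseteq> carr M" "\<And>s. s \<in> S \<Longrightarrow> decays (compress N s)" "a \<in> hclosure M S"
  shows "decays (compress N a)"
  unfolding decays_def
proof (intro allI impI)
  fix e :: real assume e: "0 < e"
  have a: "a \<in> carr M"
    using assms(3) by (simp add: hclosure_def)
  \<comment> \<open>By the factor 2 of \<open>l2norm_compress_le\<close>, an approximation error of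
    \<open>e / 4\<close> costs \<open>e / 2\<close>.\<close>
  have "0 < e / 4" "0 < e / 2"
    using e by auto
  then obtain s where s: "s \<in> S" "hnorm M (hsub M a s) < e / 4"
    using assms(3) unfolding hclosure_def by blast
  then have sM: "s \<in> carr M"
    using assms(1) by blast
  obtain d where d: "0 < d" "\<And>x. x \<in> U \<Longrightarrow> g x < d \<Longrightarrow> l2norm (compress N s x) < e / 2"
    using assms(2)[OF s(1)] \<open>0 < e / 2\<close> unfolding decays_def by blast
  have "l2norm (compress N a x) < e" if "x \<in> U" "g x < d" for x
  proof -
    have "compress N a x = (\<lambda>n. compress N (hsub M a s) x n + compress N s x n)"
      using a sM by (simp add: compress_hsub)
    then have "l2norm (compress N a x) \<le> l2norm (compress N (hsub M a s) x) + l2norm (compress N s x)"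
      using l2_add(2)[OF compress_l2[OF hsub_closed[OF a sM], of N x] compress_l2[OF sM, of N x]] by simp
    also have "\<dots> < e"
      using l2norm_compress_le[OF hsub_closed[OF a sM] that(1), of N] s(2) d(2)[OF that] by linarith
    finally show ?thesis .
  qed
  then show "\<exists>d>0. \<forall>x\<in>U. g x < d \<longrightarrow> l2norm (compress N a x) < e"
    using d(1) by blast
qed

lemma decays_gen_span:
  assumes "G \<subseteq> carr M" "\<And>s. s \<in> G \<Longrightarrow> decays (compress N s)" "a \<in> gen_span M (C0 T) G"
  shows "decays (compress N a)"
  using assms(3)
proof (induction rule: gen_span.induct)
  case gs_zero
  have z: "zer M \<in> carr M" "pls M (zer M) (zer M) = zer M"
    using hilbert_moduleD(1,6)[OF hilb] by auto
  \<comment> \<open>Additivity applied to zero plus zero equals zero.\<close>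
  have "compress N (zer M) x k = 0" for x k
    using compress_pls[OF z(1,1), of N x k] z(2) by simp
  then have "compress N (zer M) x = (\<lambda>k. 0)" for x
    by blast
  then show ?case
    by (auto simp: decays_def intro: exI[of _ 1])
next
  case (gs_gen s f)
  then have s: "s \<in> carr M"
    using assms(1) by blast
  obtain B where B: "\<And>x. cmod (f x) \<le> B"
    using C0_bounded[OF gs_gen(2)] by blast
  have B0: "0 \<le> B"
    using B[of undefined] norm_ge_zero order_trans by blast
  show ?case
    unfolding decays_def
  proof (intro allI impI)
    fix e :: real assume e: "0 < e"
    \<comment> \<open>The added 1 guards against \<open>B = 0\<close>.\<close>
    then have "0 < e / (B + 1)"
      using B0 by simp
    then obtain d where d: "0 < d" "\<And>x. x \<in> U \<Longrightarrow> g x < d \<Longrightarrow> l2norm (compress N s x) < e / (B + 1)"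
      using assms(2)[OF gs_gen(1)] unfolding decays_def by blast
    have "l2norm (compress N (ract M s f) x) < e" if "x \<in> U" "g x < d" for x
    proof -
      have "compress N (ract M s f) x = (\<lambda>k. f x * compress N s x k)"
        using s gs_gen(2) by (simp add: compress_ract fun_eq_iff)
      then have "l2norm (compress N (ract M s f) x) = cmod (f x) * l2norm (compress N s x)"
        by (simp add: l2norm_mult compress_l2[OF s])
      also have "\<dots> \<le> (B + 1) * l2norm (compress N s x)"
        using B[of x] by (intro mult_right_mono) (simp_all add: compress_l2[OF s])
      also have "\<dots> < e"
        using d(2)[OF that] B0 by (simp add: field_simps)
      finally show ?thesis .
    qed
    then show "\<exists>d>0. \<forall>x\<in>U. g x < d \<longrightarrow> l2norm (compress N (ract M s f) x) < e"
      using d(1) by blast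
  qed
next
  case (gs_add a b)
  have ab: "a \<in> carr M" "b \<in> carr M"
    using gs_add gen_span_subset[OF hilbert_moduleD(1)[OF hilb] subset_refl assms(1)] by auto
  show ?case
    unfolding decays_def
  proof (intro allI impI)
    fix e :: real assume "0 < e"
    then have e2: "0 < e / 2" by simp
    obtain d where d: "0 < d" "\<And>x. x \<in> U \<Longrightarrow> g x < d \<Longrightarrow> l2norm (compress N a x) < e / 2"
      using gs_add(3) e2 unfolding decays_def by blast
    obtain d' where d': "0 < d'" "\<And>x. x \<in> U \<Longrightarrow> g x < d' \<Longrightarrow> l2norm (compress N b x) < e / 2"
      using gs_add(4) e2 unfolding decays_def by blast
    have "l2norm (compress N (pls M a b) x) < e" if "x \<in> U" "g x < min d d'" for x
    proof -
      have "compress N (pls M a b) x = (\<lambda>n. compress N a x n + compress N b x n)"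
        using ab by (simp add: compress_pls fun_eq_iff)
      then have "l2norm (compress N (pls M a b) x) \<le> l2norm (compress N a x) + l2norm (compress N b x)"
        using l2_add(2)[OF compress_l2[OF ab(1), of N x] compress_l2[OF ab(2), of N x]] by simp
      also have "\<dots> < e"
        using d(2)[of x] d'(2)[of x] that by simp
      finally show ?thesis .
    qed
    then show "\<exists>d>0. \<forall>x\<in>U. g x < d \<longrightarrow> l2norm (compress N (pls M a b) x) < e"
      using d(1) d'(1) by (intro exI[of _ "min d d'"]) auto
  qed
qed

text \<open>A diagonal argument. On the compact set where \<open>r n <= g x\<close>, all columns
  beyond some \<open>b j n\<close> of the \<open>j\<close>-th element have norm below
  \<open>r n\<close>. \<open>N n\<close> is taken beyond these thresholds for all
  \<open>j <= n\<close>; each fixed \<open>j\<close> is then served from stage \<open>n = j\<close>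
  on, which covers a neighbourhood of the boundary.\<close>

lemma ex_columns_decay:
  fixes \<xi> :: "nat \<Rightarrow> 'm"
  assumes \<xi>: "\<And>j. \<xi> j \<in> carr M"
  shows "\<exists>N :: nat \<Rightarrow> nat. strict_mono N \<and> (\<forall>j. decays (compress N (\<xi> j)))"
proof -
  \<comment> \<open>A nonzero weight \<open>hat (1 / g x) n\<close> forces
    \<open>1 / g x < n + 1\<close>, that is \<open>r n < g x\<close>; so stage \<open>n\<close> is
    active only where its threshold applies.\<close>
  define r where "r n = inverse (real (Suc n))" for n
  have r: "0 < r n" for n
    by (simp add: r_def)
  define small where "small j n b \<longleftrightarrow> (\<forall>i\<ge>b. \<forall>x\<in>U. r n \<le> g x \<longrightarrow> l2norm (\<lambda>k. coord (\<xi> j) x (colm i k)) < r n)"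
    for j n b
  have "\<exists>b. small j n b" for j n
    unfolding small_def
  proof (rule uniformly_small_subseq[where v = "coord (\<xi> j)" and s = colm])
    show "coord (\<xi> j) x \<in> l2" for x
      by (rule coord_l2[OF \<xi>])
    show "l2cont_at T (coord (\<xi> j)) x" if "x \<in> U" for x
      by (rule l2cont_at_coord[OF \<xi> that])
  qed (rule strict_mono_colm le_colm r)+
  then have "\<forall>p. \<exists>b. small (fst p) (snd p) b"
    by blast
  from choice[OF this] obtain b' where b': "\<forall>p. small (fst p) (snd p) (b' p)"
    by (rule exE)
  define b where "b j n = b' (j, n)" for j n
  have "small j n (b j n)" for j n
    using spec[OF b', of "(j, n)"] by (simp add: b_def)
  then have b: "l2norm (\<lambda>k. coord (\<xi> j) x (colm i k)) < r n"
    if "b j n \<le> i" "x \<in> U" "r n \<le> g x" for j n i x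
    using that unfolding small_def by blast
  \<comment> \<open>The inner sum dominates every \<open>b j m\<close> with \<open>j <= m\<close>;
    \<open>Suc\<close> and the outer sum make \<open>N\<close> strictly increasing.\<close>
  define N where "N n = (\<Sum>m\<le>n. Suc (\<Sum>j\<le>m. b j m))" for n
  have "strict_mono N"
    by (simp add: strict_mono_Suc_iff N_def)
  moreover have N_ge: "b j n \<le> N n" if "j \<le> n" for j n
  proof -
    have "b j n \<le> (\<Sum>j\<le>n. b j n)"
      using that by (intro member_le_sum) auto
    also have "\<dots> \<le> Suc (\<Sum>j\<le>n. b j n)"
      by simp
    also have "\<dots> \<le> N n"
      unfolding N_def by (rule member_le_sum[of n "{..n}" "\<lambda>m. Suc (\<Sum>j\<le>m. b j m)"]) auto
    finally show ?thesis .
  qed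
  moreover have "decays (compress N (\<xi> j))" for j
    unfolding decays_def
  proof (intro allI impI)
    fix e :: real assume e: "0 < e"
    \<comment> \<open>\<open>g x < r j\<close> ensures that every active \<open>n\<close> is at
      least \<open>j\<close>. Active columns then have norm at most \<open>g x\<close>, so the blend
      is at most \<open>2 * g x\<close>, and \<open>e / 2\<close> finishes.\<close>
    have "l2norm (compress N (\<xi> j) x) < e" if x: "x \<in> U" "g x < min (r j) (e / 2)" for x
    proof -
      have gx: "0 < g x"
        using x g_pos by blast
      have le_g: "l2norm (\<lambda>k. coord (\<xi> j) x (colm (N n) k)) \<le> g x" if n: "hat (1 / g x) n \<noteq> 0" for n
      proof -
        have near: "\<bar>1 / g x - real n\<bar> < 1"
          using n by (simp add: hat_eq_0_iff)
        then have "real n < 1 / g x + 1" "1 / g x < real (Suc n)"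
          by auto
        have "inverse (r j) < inverse (g x)"
          using x gx by (intro less_imp_inverse_less) auto
        then have "real (Suc j) < 1 / g x"
          by (simp add: r_def inverse_eq_divide)
        with \<open>1 / g x < real (Suc n)\<close> have "j \<le> n"
          by linarith
        have "r n < g x"
          using \<open>1 / g x < real (Suc n)\<close> gx by (simp add: r_def field_simps)
        with b[OF N_ge[OF \<open>j \<le> n\<close>] x(1)] show ?thesis
          by simp
      qed
      have "l2norm (compress N (\<xi> j) x) \<le> 2 * g x"
        unfolding compress_def
      proof (rule l2norm_blend_le)
        show "(\<lambda>k. coord (\<xi> j) x (colm (N n) k)) \<in> l2" for n
          by (rule coord_colm_l2(1)[OF \<xi>])
      qed (use g_nonneg le_g in auto)
      also have "\<dots> < e"
        using x by simp
      finally show ?thesis .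
    qed
    then show "\<exists>d>0. \<forall>x\<in>U. g x < d \<longrightarrow> l2norm (compress N (\<xi> j) x) < e"
      using e r by (intro exI[of _ "min (r j) (e / 2)"]) auto
  qed
  ultimately show ?thesis by blast
qed

section \<open>The complemented copy of \<open>l2mod T U\<close> inside \<open>M\<close>\<close>

lemma compress_in_L:
  assumes "a \<in> carr M" "decays (compress N a)"
  shows "compress N a \<in> L"
  by (rule l2modI_decays[OF compress_l2[OF assms(1)] _ l2cont_at_compress[OF assms(1)] assms(2)])
    (simp_all add: compress_def blend_outside)

text \<open>Pointwise the norm is at most twice that of \<open>v\<close>, so it tends to 0 wherever
  that of \<open>v\<close> does: at points outside \<open>U\<close> and at infinity.\<close>

lemma spread_in_L:
  assumes "v \<in> L"
  shows "spread N v \<in> L"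
proof (rule l2modI)
  have v: "\<And>x. v x \<in> l2" "\<And>x. x \<in> topspace T \<Longrightarrow> l2cont_at T v x" "\<And>x. x \<notin> U \<Longrightarrow> v x = (\<lambda>n. 0)"
    "((\<lambda>x. l2norm (v x)) \<longlongrightarrow> 0) (at_inf T)"
    using assms by (auto simp: mem_l2mod)
  show l2: "spread N v x \<in> l2" for x
    unfolding spread_def by (rule blend_l2) (rule l2_embed[OF v(1) strict_mono_colm])
  show "spread N v x = (\<lambda>n. 0)" if "x \<notin> U" for x
    using that by (simp add: spread_def blend_outside)
  show "l2cont_at T (spread N v) x" if "x \<in> U" for x
    unfolding spread_def
    by (rule l2cont_at_blend[OF that l2_embed[OF v(1) strict_mono_colm]
      l2cont_at_embed[OF v(2)[OF U_topspace[OF that]] strict_mono_colm]])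
  have le: "l2norm (spread N v x) \<le> 2 * l2norm (v x)" for x
    unfolding spread_def
    by (rule l2norm_blend_le) (simp_all add: v(1) l2_embed l2norm_embed strict_mono_colm)
  have tends: "((\<lambda>x. l2norm (spread N v x)) \<longlongrightarrow> 0) F" if "((\<lambda>x. l2norm (v x)) \<longlongrightarrow> 0) F" for F
    by (rule tendsto_0_le[OF that, of _ 2]) (use le v(1) l2 in \<open>simp add: mult.commute\<close>)
  show "((\<lambda>y. l2norm (spread N v y)) \<longlongrightarrow> 0) (atin T x)" if "x \<in> topspace T - U" for x
    using v(2)[of x] v(3)[of x] that by (intro tends) (simp add: l2cont_at_def)
  show "((\<lambda>y. l2norm (spread N v y)) \<longlongrightarrow> 0) (at_inf T)"
    using v(4) by (rule tends)
qed

text \<open>Placing a vector in a column is adjoint to reading that column off, and the real weights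
  pass through the conjugation.\<close>

lemma l2ip_spread:
  assumes "v \<in> L" "a \<in> carr M" "x \<in> U"
  shows "l2ip (spread N v x) (coord a x) = l2ip (v x) (compress N a x)"
proof -
  let ?A = "{..nat \<lceil>1 / g x\<rceil>}" and ?h = "\<lambda>n. complex_of_real (hat (1 / g x) n)"
  have v: "v x \<in> l2"
    using assms by (simp add: mem_l2mod)
  have e: "embed (colm i) (v x) \<in> l2" for i
    by (rule l2_embed[OF v strict_mono_colm])
  have c: "(\<lambda>k. coord a x (colm i k)) \<in> l2" for i
    by (rule coord_colm_l2[OF assms(2)])
  have "l2ip (spread N v x) (coord a x) = (\<Sum>n\<in>?A. l2ip (\<lambda>j. ?h n * embed (colm (N n)) (v x) j) (coord a x))"
    unfolding spread_def blend_def using assms(3)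
      l2ip_sum_left[of ?A "coord a x" "\<lambda>n j. ?h n * embed (colm (N n)) (v x) j"]
    by (simp add: coord_l2[OF assms(2)] l2_mult e)
  also have "\<dots> = (\<Sum>n\<in>?A. ?h n * l2ip (v x) (\<lambda>k. coord a x (colm (N n) k)))"
    by (simp add: l2ip_mult_left coord_l2[OF assms(2)] e l2ip_embed_left strict_mono_colm)
  also have "\<dots> = (\<Sum>n\<in>?A. l2ip (v x) (\<lambda>k. ?h n * coord a x (colm (N n) k)))"
    by (simp add: l2ip_mult_right v c)
  also have "\<dots> = l2ip (v x) (compress N a x)"
    unfolding compress_def blend_def using assms(3)
      l2ip_sum_right[of ?A "v x" "\<lambda>n k. ?h n * coord a x (colm (N n) k)"]
    by (simp add: v l2_mult c)
  finally show ?thesis .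
qed

definition incl :: "(nat \<Rightarrow> nat) \<Rightarrow> ('x \<Rightarrow> nat \<Rightarrow> complex) \<Rightarrow> 'm" where
  "incl N v = inv_into R \<psi> (spread N v)"

lemma incl_in_R: "v \<in> L \<Longrightarrow> incl N v \<in> R"
  and psi_incl: "v \<in> L \<Longrightarrow> \<psi> (incl N v) = spread N v"
  using bij spread_in_L by (auto simp: incl_def bij_betw_def intro: inv_into_into f_inv_into_f)

lemma ipr_incl:
  assumes "v \<in> L" "a \<in> carr M"
  shows "ipr M (incl N v) a x = l2ip (v x) (compress N a x)"
proof (cases "x \<in> U")
  case True
  have "ipr M (incl N v) a x = l2ip (coord (incl N v) x) (coord a x)"
    using R_subset incl_in_R[OF assms(1)] assms(2) True by (intro l2ip_coord[symmetric]) auto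
  also have "\<dots> = l2ip (spread N v x) (coord a x)"
    using coord_R[OF incl_in_R[OF assms(1)] True] psi_incl[OF assms(1)] by simp
  finally show ?thesis
    using l2ip_spread[OF assms True] by simp
next
  case False
  \<comment> \<open>Outside \<open>U\<close> there are no coordinates to compare. Instead the
    embedded element is null at \<open>x\<close>, and so pairs to 0 with all of \<open>M\<close>
    there.\<close>
  have "ipr M (incl N v) (incl N v) x = l2ip (spread N v x) (spread N v x)"
    using psi_ipr[OF incl_in_R[OF assms(1)] incl_in_R[OF assms(1)]] psi_incl[OF assms(1)] by metis
  then have "ipr M (incl N v) (incl N v) x = 0"
    using False by (simp add: spread_def blend_outside)
  then have "ipr M (incl N v) a x = 0"
    using ipr_eq_0_if_null[OF hilb] R_subset incl_in_R[OF assms(1)] assms(2) by blast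
  then show ?thesis
    using False by (simp add: compress_def blend_outside)
qed

text \<open>Contracting \<open>v x\<close> tensor a unit vector against the same unit vector
  multiplies \<open>v x\<close> by the square of its norm, which is 1.\<close>

lemma compress_incl:
  assumes "v \<in> L" "strict_mono N"
  shows "compress N (incl N v) = v"
proof (intro ext)
  fix x k
  show "compress N (incl N v) x k = v x k"
  proof (cases "x \<in> U")
    case True
    let ?K = "nat \<lceil>1 / g x\<rceil>" and ?h = "\<lambda>n. complex_of_real (hat (1 / g x) n)"
    \<comment> \<open>Distinct stages must use distinct columns; otherwise cross terms of the
      weights would survive in column \<open>N n\<close>.\<close>
    have inj: "N m = N n \<longleftrightarrow> m = n" for m n
      using assms(2) by (simp add: strict_mono_eq)
    have c: "coord (incl N v) x = spread N v x"
      using coord_R[OF incl_in_R[OF assms(1)] True] psi_incl[OF assms(1)] by simp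
    have s: "spread N v x (colm (N n) k) = ?h n * v x k" if "n \<le> ?K" for n
    proof -
      have "spread N v x (colm (N n) k) = (\<Sum>m\<le>?K. if m = n then ?h m * v x k else 0)"
        unfolding spread_def blend_def using True
        by (simp add: embed_colm inj if_distrib[of "\<lambda>z. _ * z"] cong: if_cong)
      then show ?thesis
        using that by simp
    qed
    have "compress N (incl N v) x k = (\<Sum>n\<le>?K. ?h n * (?h n * v x k))"
      unfolding compress_def blend_def using True s by (simp add: c)
    also have "\<dots> = complex_of_real (\<Sum>n\<le>?K. (hat (1 / g x) n)\<^sup>2) * v x k"
      by (simp add: sum_distrib_right power2_eq_square mult.assoc)
    also have "(\<Sum>n\<le>?K. (hat (1 / g x) n)\<^sup>2) = 1"
      by (rule sum_hat_squares) (simp add: g_nonneg, linarith)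
    finally show ?thesis by simp
  next
    case False
    then show ?thesis
      using assms(1) by (simp add: compress_def blend_outside mem_l2mod)
  qed
qed

lemma hiso_absorb:
  assumes "countably_generated T M"
  shows "hiso T M (dsum M (l2mod T U))"
proof -
  have z: "zer M \<in> carr M"
    using hilbert_moduleD(1)[OF hilb] .
  obtain G where G: "countable G" "G \<subseteq> carr M" "carr M \<subseteq> hclosure M (gen_span M (C0 T) G)"
    using assms unfolding countably_generated_def by blast
  \<comment> \<open>Adding zero makes the set nonempty, so that \<open>from_nat_into\<close>
    enumerates it even for an empty \<open>G\<close>.\<close>
  define \<xi> where "\<xi> = from_nat_into (insert (zer M) G)"
  have range: "range \<xi> = insert (zer M) G"
    unfolding \<xi>_def using G(1) by (intro range_from_nat_into) auto
  have \<xi>: "\<xi> j \<in> carr M" for j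
    using range z G(2) rangeI[of \<xi> j] by auto
  obtain N where N: "strict_mono N" "\<And>j. decays (compress N (\<xi> j))"
    using ex_columns_decay[of \<xi>, OF \<xi>] by blast
  have "decays (compress N s)" if "s \<in> G" for s
  proof -
    have "s \<in> range \<xi>"
      using range that by simp
    then show ?thesis
      using N(2) by blast
  qed
  then have dG: "decays (compress N s)" if "s \<in> gen_span M (C0 T) G" for s
    using decays_gen_span[OF G(2) _ that] by simp
  \<comment> \<open>Decay passes from the generators to their span and then to its closure, which is
    all of \<open>M\<close>; only now does the adjoint take values in \<open>L\<close> on the whole
    module.\<close>
  have compress: "compress N a \<in> L" if "a \<in> carr M" for a
  proof (rule compress_in_L[OF that])
    show "decays (compress N a)"
      by (rule decays_closed[OF gen_span_subset[OF z subset_refl G(2)] dG subsetD[OF G(3) that]])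
  qed
  show ?thesis
  proof (rule hiso_dsum_absorb[where P = "compress N" and Q = "incl N" and A = "\<lambda>v x n. v x (2 * n)"
        and B = "\<lambda>v x n. v x (2 * n + 1)"])
    show "ip_module T M" ..
    show "ip_module T (l2mod T U)"
      by (rule ip_module_l2mod)
    show "incl N v \<in> carr M" if "v \<in> L" for v
      using incl_in_R[OF that] R_subset by blast
    show "ipr M (incl N v) m x = ipr (l2mod T U) v (compress N m) x" if "v \<in> L" "m \<in> carr M" for v m x
      using ipr_incl[OF that] by simp
    show "compress N (incl N v) = v" if "v \<in> L" for v
      using that N(1) by (rule compress_incl)
    show "(\<lambda>x n. v x (2 * n)) \<in> L" if "v \<in> L" for v
      by (rule l2mod_comp_closed[where s = "\<lambda>n. 2 * n", OF that]) (simp add: strict_mono_def)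
    show "(\<lambda>x n. v x (2 * n + 1)) \<in> L" if "v \<in> L" for v
      by (rule l2mod_comp_closed[where s = "\<lambda>n. 2 * n + 1", OF that]) (simp add: strict_mono_def)
    show "ipr (l2mod T U) (\<lambda>x n. v x (2 * n)) (\<lambda>x n. w x (2 * n)) x
        + ipr (l2mod T U) (\<lambda>x n. v x (2 * n + 1)) (\<lambda>x n. w x (2 * n + 1)) x = ipr (l2mod T U) v w x"
      if "v \<in> L" "w \<in> L" for v w x
      unfolding l2mod_sel by (rule l2mod_split(1)[OF that])
    show "\<exists>p\<in>L. (\<lambda>x n. p x (2 * n)) = v \<and> (\<lambda>x n. p x (2 * n + 1)) = w" if "v \<in> L" "w \<in> L" for v w
      using l2mod_split(2)[OF that] .
    show "carr M \<noteq> {}"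
      using z by blast
  qed (rule compress)
qed

end

theorem theorem6p7:
  fixes T :: "'x topology" and U :: "'x set" and M :: "('m, 'x) hmod"
  assumes "locally_compact_space T" and "Hausdorff_space T"
    and "openin T U"
    and "\<exists>K :: nat \<Rightarrow> 'x set. (\<forall>n. compactin T (K n)) \<and> U = (\<Union>n. K n)"
    and "hilbert_module T M" and "countably_generated T M"
    and "hiso T (restrict_mod T M U) (l2mod T U)"
  shows "hiso T M (dsum M (l2mod T U))"
proof -
  obtain K :: "nat \<Rightarrow> 'x set" where K: "\<And>n. compactin T (K n)" "U = (\<Union>n. K n)"
    using assms(4) by blast
  obtain g :: "'x \<Rightarrow> real" where g: "(\<lambda>x. complex_of_real (g x)) \<in> C0 T" "\<And>x. 0 \<le> g x" "\<And>x. 0 < g x \<longleftrightarrow> x \<in> U"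
    using ex_C0_pos_iff[OF assms(1-3) K] by blast
  let ?R = "restrict_mod T M U"
  \<comment> \<open>Restriction changes only the carrier, so the given isomorphism can be read with
    the operations of \<open>M\<close>.\<close>
  have R: "pls ?R = pls M" "smul ?R = smul M" "ract ?R = ract M" "ipr ?R = ipr M"
    by (simp_all add: restrict_mod_def)
  obtain \<psi> where bij: "bij_betw \<psi> (carr ?R) (carr (l2mod T U))"
    and pls: "\<forall>a\<in>carr ?R. \<forall>b\<in>carr ?R. \<psi> (pls M a b) = (\<lambda>x n. \<psi> a x n + \<psi> b x n)"
    and smul: "\<forall>c. \<forall>a\<in>carr ?R. \<psi> (smul M c a) = (\<lambda>x n. c * \<psi> a x n)"
    and ract: "\<forall>a\<in>carr ?R. \<forall>f\<in>C0 T. \<psi> (ract M a f) = (\<lambda>x n. \<psi> a x n * f x)"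
    and ipr: "\<forall>a\<in>carr ?R. \<forall>b\<in>carr ?R. (\<lambda>x. l2ip (\<psi> a x) (\<psi> b x)) = ipr M a b"
    using assms(7)[unfolded hiso_def R l2mod_sel] by (elim exE conjE)
  interpret trivialized_module T U g M \<psi>
  proof
    fix a b x assume "a \<in> carr ?R" "b \<in> carr ?R"
    then show "l2ip (\<psi> a x) (\<psi> b x) = ipr M a b x"
      using ipr fun_cong[of _ _ x] by blast
  qed (simp_all add: assms g bij pls smul ract)
  show ?thesis
    using assms(6) by (rule hiso_absorb)
qed

end
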